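(* Let $\mathcal{U},\mathcal{V},\mathcal{X},\mathcal{Y}$ be finite alphabets with $0\in\mathcal{X}$, let $P_{UV},Q_{UV}$ be pmfs on $\mathcal{U}\times\mathcal{V}$ with $Q_{UV}(u,v)>0$ for all $(u,v)$, and let $c:\mathcal{X}\to[0,\infty)$ be a cost function with $c(x)=0$ if and only if $x=0$. For any discrete memoryless channel $\Gamma_{Y|X}$ from $\mathcal{X}$ to $\mathcal{Y}$, any sequence of cost constraints $\{C_n\}$ with $\lim_{n\to\infty}C_n=\infty$ and $\lim_{n\to\infty}C_n/n=0$, and any sequence of positive integers $\{k(n)\}$ with $\lim_{n\to\infty}k(n)=\infty$ and $\lim_{n\to\infty}k(n)/n=0$, $$\theta^\star_{\mathrm{str\text{-}cost}}(\epsilon,\{C_n\})=\theta^\star_{\mathrm{sublin}}(\epsilon),\qquad\forall\,\epsilon\in[0,1),$$ where $\theta^\star_{\mathrm{str\text{-}cost}}(\epsilon,\{C_n\})$ is the Stein-exponent with $n$ channel uses under the almost-sure cost constraint $\sum_{i=1}^n c(X_i)\le C_n$, and $\theta^\star_{\mathrm{sublin}}(\epsilon)$ is the Stein-exponent with $k(n)$ channel uses and no cost constraint (both defined in the context).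
   Context: Common setup. For each blocklength $n$, a sensor observes $U^n$ and a decision center observes $V^n$. Under hypothesis $\mathcal{H}=0$ the pairs $(U_i,V_i)$, $i=1,\dots,n$, are i.i.d. $\sim P_{UV}$; under $\mathcal{H}=1$ they are i.i.d. $\sim Q_{UV}$. The sensor communicates to the decision center over $m$ uses of the discrete memoryless channel $\Gamma_{Y|X}$: an encoding function $f^{(n)}:\mathcal{U}^n\to\mathcal{X}^m$ produces $X^m=f^{(n)}(U^n)$; given $X^m=x^m$ (and whatever the values of $U^n$, $V^n$ and the hypothesis), the output $Y^m$ has pmf $\prod_{i=1}^m\Gamma_{Y|X}(y_i|x_i)$; a decision function $g^{(n)}:\mathcal{V}^n\times\mathcal{Y}^m\to\{0,1\}$ produces $\hat{\mathcal{H}}=g^{(n)}(V^n,Y^m)$. Error probabilities: $\alpha_n=\Pr[\hat{\mathcal{H}}=1|\mathcal{H}=0]$ and $\beta_n=\Pr[\hat{\mathcal{H}}=0|\mathcal{H}=1]$. Achievability criteria for an exponent $\theta>0$: (i) $\limsup_{n\to\infty}\alpha_n\le\epsilon$ and (ii) $\liminf_{n\to\infty}-\frac1n\log\beta_n\ge\theta$. Definition of $\theta^\star_{\mathrm{sublin}}(\epsilon)$: take $m=k(n)$; it is the supremum of all $\theta>0$ for which there exists a sequence $\{(f^{(n)},g^{(n)})\}_{n\ge1}$ satisfying (i) and (ii). Definition of $\theta^\star_{\mathrm{str\text{-}cost}}(\epsilon,\{C_n\})$: take $m=n$; it is the supremum of all $\theta>0$ for which there exists a sequence $\{(f^{(n)},g^{(n)})\}_{n\ge1}$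 satisfying (i), (ii), and, for every $n$, $\sum_{i=1}^n c(X_i)\le C_n$ with probability $1$. In both cases the supremum of the empty set is taken to be $0$.
   Formalization: The cost constraints are assumed to satisfy C_n ≥ 0 for every n ≥ 1; if some C_n were negative, no encoder could meet the constraint, the cost-constrained exponent would be 0 by convention, and the equality would fail in general. *)

theory Defs
  imports "HOL-Probability.Probability"
begin

text \<open>
  A sequence in \<open>A\<^sup>n\<close> is a function on \<^typ>\<open>nat\<close> whose relevant coordinates are \<open>0, \<dots>, n - 1\<close>;
  the random sequences below take a fixed value at all other coordinates, so encoders and
  decision functions receive exactly the length-\<open>n\<close> observations. The coordinates \<open>i \<ge> m\<close> of an
  encoder output are ignored.

  Decisions are Booleans: \<^term>\<open>False\<close> stands for the decision 0 and \<^term>\<open>True\<close> for the decision 1.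
\<close>

type_synonym ('u, 'x) encoder = "(nat \<Rightarrow> 'u) \<Rightarrow> (nat \<Rightarrow> 'x)"
type_synonym ('v, 'y) decider = "(nat \<Rightarrow> 'v) \<Rightarrow> (nat \<Rightarrow> 'y) \<Rightarrow> bool"

text \<open>Joint law of \<open>(U\<^sup>n, V\<^sup>n, X\<^sup>m, Y\<^sup>m)\<close> when the source pairs are i.i.d. with law \<open>R\<close>.\<close>

definition system_pmf ::
  "('u \<times> 'v) pmf \<Rightarrow> ('x \<Rightarrow> 'y pmf) \<Rightarrow> nat \<Rightarrow> nat \<Rightarrow> ('u, 'x) encoder \<Rightarrow>
    ((nat \<Rightarrow> 'u) \<times> (nat \<Rightarrow> 'v) \<times> (nat \<Rightarrow> 'x) \<times> (nat \<Rightarrow> 'y)) pmf" where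
  "system_pmf R \<Gamma> n m f =
    do {
      w \<leftarrow> Pi_pmf {..<n} (undefined, undefined) (\<lambda>_. R);
      let u = (\<lambda>i. fst (w i));
      let v = (\<lambda>i. snd (w i));
      let x = f u;
      y \<leftarrow> Pi_pmf {..<m} undefined (\<lambda>i. \<Gamma> (x i));
      return_pmf (u, v, x, y)
    }"

definition type1_error ::
  "('u \<times> 'v) pmf \<Rightarrow> ('x \<Rightarrow> 'y pmf) \<Rightarrow> nat \<Rightarrow> nat \<Rightarrow> ('u, 'x) encoder \<Rightarrow> ('v, 'y) decider \<Rightarrow> real" where
  "type1_error P \<Gamma> n m f g = measure_pmf.prob (system_pmf P \<Gamma> n m f) {(u, v, x, y). g v y}"

definition type2_error ::
  "('u \<times> 'v) pmf \<Rightarrow> ('x \<Rightarrow> 'y pmf) \<Rightarrow> nat \<Rightarrow> nat \<Rightarrow> ('u, 'x) encoder \<Rightarrow> ('v, 'y) decider \<Rightarrow> real" where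
  "type2_error Q \<Gamma> n m f g = measure_pmf.prob (system_pmf Q \<Gamma> n m f) {(u, v, x, y). \<not> g v y}"

text \<open>\<open>- (1/n) log p\<close>, with value \<open>\<infinity>\<close> at \<open>p = 0\<close> (whereas \<^term>\<open>ln (0 :: real) = 0\<close>).\<close>

definition error_exponent :: "nat \<Rightarrow> real \<Rightarrow> ereal" where
  "error_exponent n p = (if p = 0 then \<infinity> else ereal (- (1 / real n) * ln p))"

definition achieves ::
  "('u \<times> 'v) pmf \<Rightarrow> ('u \<times> 'v) pmf \<Rightarrow> ('x \<Rightarrow> 'y pmf) \<Rightarrow> (nat \<Rightarrow> nat) \<Rightarrow> real \<Rightarrow> real \<Rightarrow>
    (nat \<Rightarrow> ('u, 'x) encoder) \<Rightarrow> (nat \<Rightarrow> ('v, 'y) decider) \<Rightarrow> bool" where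
  "achieves P Q \<Gamma> m \<epsilon> \<theta> f g \<longleftrightarrow>
    limsup (\<lambda>n. ereal (type1_error P \<Gamma> n (m n) (f n) (g n))) \<le> ereal \<epsilon> \<and>
    liminf (\<lambda>n. error_exponent n (type2_error Q \<Gamma> n (m n) (f n) (g n))) \<ge> ereal \<theta>"

text \<open>The cost constraint holds almost surely when the source pairs have law \<open>R\<close>.\<close>

definition meets_cost ::
  "('u \<times> 'v) pmf \<Rightarrow> ('x \<Rightarrow> 'y pmf) \<Rightarrow> ('x \<Rightarrow> real) \<Rightarrow> real \<Rightarrow> nat \<Rightarrow> ('u, 'x) encoder \<Rightarrow> bool" where
  "meets_cost R \<Gamma> c B n f \<longleftrightarrow>
    (AE (u, v, x, y) in measure_pmf (system_pmf R \<Gamma> n n f). (\<Sum>i<n. c (x i)) \<le> B)"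

definition exponent_Sup :: "real set \<Rightarrow> ereal" where
  "exponent_Sup S = (if S = {} then 0 else Sup (ereal ` S))"

definition theta_sublin ::
  "('u \<times> 'v) pmf \<Rightarrow> ('u \<times> 'v) pmf \<Rightarrow> ('x \<Rightarrow> 'y pmf) \<Rightarrow> (nat \<Rightarrow> nat) \<Rightarrow> real \<Rightarrow> ereal" where
  "theta_sublin P Q \<Gamma> k \<epsilon> = exponent_Sup {\<theta>. \<theta> > 0 \<and> (\<exists>f g. achieves P Q \<Gamma> k \<epsilon> \<theta> f g)}"

text \<open>Probability 1 is required under both hypotheses.\<close>

definition theta_str_cost ::
  "('u \<times> 'v) pmf \<Rightarrow> ('u \<times> 'v) pmf \<Rightarrow> ('x \<Rightarrow> 'y pmf) \<Rightarrow> ('x \<Rightarrow> real) \<Rightarrow> real \<Rightarrow> (nat \<Rightarrow> real) \<Rightarrow> ereal" where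
  "theta_str_cost P Q \<Gamma> c \<epsilon> C =
    exponent_Sup {\<theta>. \<theta> > 0 \<and>
      (\<exists>f g. achieves P Q \<Gamma> (\<lambda>n. n) \<epsilon> \<theta> f g \<and>
        (\<forall>n\<ge>1. meets_cost P \<Gamma> c (C n) n (f n) \<and> meets_cost Q \<Gamma> c (C n) n (f n)))}"

end

theory Submission
  imports Defs "HOL-Real_Asymp.Real_Asymp"
begin

text \<open>
  Both exponents equal the exponential decay rate of the \<open>Q\<^sup>n\<close>-probability that the observations look typical
  for \<open>P\<close>: those of the decision center alone if all channel inputs have the same output support, and
  those of both terminals otherwise. That rate involves neither \<open>k\<close> nor \<open>C\<close>.

  Achievability: if \<open>b\<close> is a possible output for \<open>x1\<close> and impossible for \<open>x0\<close>, the sensor repeats \<open>x1\<close> or \<open>x0\<close>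
  according to the typicality of \<open>U\<^sup>n\<close>, and the decision center accepts if \<open>V\<^sup>n\<close> is typical and \<open>b\<close> is seen.
  A number of repetitions growing arbitrarily slowly suffices.

  Converse: sublinear communication reduces acceptance to a product test \<open>h1(U\<^sup>n) h2(V\<^sup>n)\<close> whose factors have
  mean \<open>exp (- o(n))\<close> under \<open>P\<^sup>n\<close>. In place of the blowing-up lemma, \<open>h1\<close> and \<open>h2\<close> are smoothed by the kernel
  \<open>\<Prod>i. ([x i = a i] + r)\<close>. Since \<open>Q > 0\<close>, this costs only a factor \<open>(1 + O(r))\<^sup>n\<close> under \<open>Q\<^sup>n\<close>, while the smoothed
  functions are at least \<open>exp (- o(n))\<close> outside sets of exponentially small probability. For each typical joint
  type, Gibbs' variational inequality then bounds the mean of the product of the smoothed functions from below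
  by the \<open>Q\<^sup>n\<close>-probability of that type, and there are polynomially many types.
\<close>

section \<open>Finite sequences and means under product weights\<close>

definition seqs :: "nat \<Rightarrow> 'a \<Rightarrow> (nat \<Rightarrow> 'a) set" where
  "seqs n d = {x. \<forall>i\<ge>n. x i = d}"

text \<open>The weights \<open>p\<close> are a plain real function, so that pmfs, their marginals
  and empirical frequencies can all be inserted. Lemmas that need total weight 1 assume it.\<close>

definition mean :: "nat \<Rightarrow> 'a::finite \<Rightarrow> ('a \<Rightarrow> real) \<Rightarrow> ((nat \<Rightarrow> 'a) \<Rightarrow> real) \<Rightarrow> real" where
  "mean n d p h = (\<Sum>x\<in>seqs n d. (\<Prod>i<n. p (x i)) * h x)"

lemma seqs_0: "seqs 0 d = {\<lambda>_. d}"
  by (auto simp: seqs_def)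

lemma bij_betw_seqs_Suc:
  "bij_betw (\<lambda>(a, x). x(n := a)) (UNIV \<times> seqs n d) (seqs (Suc n) d)"
proof (rule bij_betw_byWitness[where f' = "\<lambda>x. (x n, x(n := d))"])
  show "\<forall>z\<in>UNIV \<times> seqs n d. (\<lambda>x. (x n, x(n := d))) ((\<lambda>(a, x). x(n := a)) z) = z"
    by (auto simp: seqs_def fun_eq_iff)
qed (auto simp: seqs_def Suc_le_eq)

lemma finite_seqs [simp, intro]: "finite (seqs n (d :: 'a::finite))"
proof (induction n)
  case (Suc n)
  then show ?case
    using bij_betw_finite[OF bij_betw_seqs_Suc[of n d]] by simp
qed (simp add: seqs_0)

lemma sum_seqs_Suc:
  fixes d :: "'a::finite"
  shows "sum h (seqs (Suc n) d) = (\<Sum>a\<in>UNIV. \<Sum>x\<in>seqs n d. h (x(n := a)))"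
  by (simp add: sum.reindex_bij_betw[OF bij_betw_seqs_Suc, symmetric] sum.cartesian_product
      case_prod_unfold)

lemma sum_seqs_prod:
  fixes d :: "'a::finite" and h :: "nat \<Rightarrow> 'a \<Rightarrow> real"
  shows "(\<Sum>x\<in>seqs n d. \<Prod>i<n. h i (x i)) = (\<Prod>i<n. \<Sum>a\<in>UNIV. h i a)"
proof (induction n)
  case (Suc n)
  then show ?case
    by (simp add: sum_seqs_Suc sum_distrib_right mult.commute flip: sum_distrib_left)
qed (simp add: seqs_0)

lemma mean_0 [simp]: "mean 0 d p h = h (\<lambda>_. d)"
  by (simp add: mean_def seqs_0)

lemma mean_Suc: "mean (Suc n) d p h = (\<Sum>a\<in>UNIV. p a * mean n d p (\<lambda>x. h (x(n := a))))"
  by (simp add: mean_def sum_seqs_Suc sum_distrib_left mult_ac)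

lemma mean_add: "mean n d p (\<lambda>x. f x + g x) = mean n d p f + mean n d p g"
  by (simp add: mean_def distrib_left sum.distrib)

lemma mean_cmult: "mean n d p (\<lambda>x. k * f x) = k * mean n d p f"
  by (simp add: mean_def sum_distrib_left mult_ac)

lemma mean_sum: "mean n d p (\<lambda>x. \<Sum>a\<in>S. f a x) = (\<Sum>a\<in>S. mean n d p (f a))"
  by (simp add: mean_def sum_distrib_left) (rule sum.swap)

lemma mean_cong: "(\<And>x. x \<in> seqs n d \<Longrightarrow> f x = g x) \<Longrightarrow> mean n d p f = mean n d p g"
  by (simp add: mean_def)

lemma mean_prod: "mean n d p (\<lambda>x. \<Prod>i<n. h i (x i)) = (\<Prod>i<n. \<Sum>a\<in>UNIV. p a * h i a)"
  using sum_seqs_prod[of "\<lambda>i a. p a * h i a" n d] by (simp add: mean_def prod.distrib)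

lemma mean_const: "sum p UNIV = 1 \<Longrightarrow> mean n d p (\<lambda>_. k) = k"
  using mean_cmult[of n d p k "\<lambda>_. 1"] mean_prod[of n d p "\<lambda>_ _. 1"] by simp

lemma mean_mono:
  assumes "\<And>a. p a \<ge> 0" and "\<And>x. x \<in> seqs n d \<Longrightarrow> f x \<le> g x"
  shows "mean n d p f \<le> mean n d p g"
  unfolding mean_def using assms by (intro sum_mono mult_left_mono prod_nonneg) auto

lemma mean_nonneg:
  assumes "\<And>a. p a \<ge> 0" and "\<And>x. x \<in> seqs n d \<Longrightarrow> f x \<ge> 0"
  shows "mean n d p f \<ge> 0"
  unfolding mean_def using assms by (intro sum_nonneg mult_nonneg_nonneg prod_nonneg) auto

text \<open>The ratio of two product laws is a product of single-letter ratios, each at most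
  \<open>K\<close>. This moves means under a typical type to means under the source law.\<close>

lemma mean_change_weights:
  assumes "\<And>a. 0 \<le> p a" "\<And>a. p a \<le> K * q a" and "\<And>x. x \<in> seqs n d \<Longrightarrow> f x \<ge> 0"
  shows "mean n d p f \<le> K ^ n * mean n d q f"
proof -
  have "(\<Prod>i<n. p (x i)) \<le> K ^ n * (\<Prod>i<n. q (x i))" for x
    using prod_mono[of "{..<n}" "\<lambda>i. p (x i)" "\<lambda>i. K * q (x i)"] assms
    by (simp add: prod.distrib)
  then show ?thesis
    unfolding mean_def sum_distrib_left mult.assoc[symmetric]
    by (intro sum_mono mult_right_mono assms)
qed

text \<open>The image of a product law under a letterwise map is the product of the image laws; the
  induction groups the last letter by the fibres of \<open>\<pi>\<close>. With \<open>fst\<close>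
  and \<open>snd\<close> it produces the marginals.\<close>

lemma mean_image:
  "mean n d p (\<lambda>w. h (\<lambda>i. \<pi> (w i))) = mean n (\<pi> d) (\<lambda>b. \<Sum>a | \<pi> a = b. p a) h"
proof (induction n arbitrary: h)
  case (Suc n)
  have "(\<lambda>i. \<pi> ((w(n := a)) i)) = (\<lambda>i. \<pi> (w i))(n := \<pi> a)" for w :: "nat \<Rightarrow> 'a" and a
    by auto
  then have "mean (Suc n) d p (\<lambda>w. h (\<lambda>i. \<pi> (w i)))
      = (\<Sum>a\<in>UNIV. p a * mean n d p (\<lambda>w. h ((\<lambda>i. \<pi> (w i))(n := \<pi> a))))"
    by (simp only: mean_Suc)
  also have "\<dots> = (\<Sum>a\<in>UNIV. p a * mean n (\<pi> d) (\<lambda>b. \<Sum>a | \<pi> a = b. p a) (\<lambda>u. h (u(n := \<pi> a))))"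
    by (simp only: Suc.IH[of "\<lambda>u. h (u(n := \<pi> _))"])
  also have "\<dots> = (\<Sum>b\<in>UNIV. \<Sum>a | \<pi> a = b. p a * mean n (\<pi> d) (\<lambda>b. \<Sum>a | \<pi> a = b. p a) (\<lambda>u. h (u(n := \<pi> a))))"
    by (subst sum.group[of UNIV UNIV \<pi>, symmetric]) (auto intro!: sum.cong)
  also have "\<dots> = mean (Suc n) (\<pi> d) (\<lambda>b. \<Sum>a | \<pi> a = b. p a) h"
    by (simp add: mean_Suc sum_distrib_right)
  finally show ?case .
qed simp

lemma mean_sum_coords:
  assumes "sum p UNIV = 1"
  shows "mean n d p (\<lambda>x. \<Sum>i<n. f (x i)) = real n * (\<Sum>a\<in>UNIV. p a * f a)"
proof (induction n)
  case (Suc n)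
  have "mean (Suc n) d p (\<lambda>x. \<Sum>i<Suc n. f (x i))
      = (\<Sum>a\<in>UNIV. p a * mean n d p (\<lambda>x. (\<Sum>i<n. f (x i)) + f a))"
    unfolding mean_Suc by (intro sum.cong refl arg_cong2[of _ _ _ _ "(*)"] mean_cong) simp
  also have "\<dots> = (\<Sum>a\<in>UNIV. p a * (real n * (\<Sum>a\<in>UNIV. p a * f a)) + p a * f a)"
    by (simp add: mean_add mean_const[OF assms] Suc.IH distrib_left)
  also have "\<dots> = real (Suc n) * (\<Sum>a\<in>UNIV. p a * f a)"
    by (simp add: sum.distrib assms distrib_right flip: sum_distrib_right)
  finally show ?case .
qed simp

lemma mean_pos:
  assumes "\<And>a. p a \<ge> 0" "sum p UNIV = 1" and "\<And>x. x \<in> seqs n d \<Longrightarrow> f x > 0"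
  shows "mean n d p f > 0"
proof -
  define m where "m = Min (f ` seqs n d)"
  have ne: "seqs n d \<noteq> {}" by (auto simp: seqs_def)
  have "m > 0" "\<And>x. x \<in> seqs n d \<Longrightarrow> m \<le> f x"
    using ne assms(3) by (auto simp: m_def)
  then have "mean n d p (\<lambda>_. m) \<le> mean n d p f"
    by (intro mean_mono assms)
  with \<open>m > 0\<close> show ?thesis by (simp add: mean_const assms)
qed

text \<open>Jensen's inequality for the concave logarithm, obtained from its tangent line at the
  mean.\<close>

lemma mean_ln_le:
  assumes "\<And>a. p a \<ge> 0" "sum p UNIV = 1" and "\<And>x. x \<in> seqs n d \<Longrightarrow> z x > 0"
  shows "mean n d p (\<lambda>x. ln (z x)) \<le> ln (mean n d p z)"
proof -
  let ?m = "mean n d p z"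
  have m: "?m > 0" by (intro mean_pos assms)
  have "mean n d p (\<lambda>x. ln (z x)) \<le> mean n d p (\<lambda>x. (ln ?m - 1) + 1 / ?m * z x)"
  proof (rule mean_mono)
    fix x assume "x \<in> seqs n d"
    then show "ln (z x) \<le> (ln ?m - 1) + 1 / ?m * z x"
      using ln_le_minus_one[of "z x / ?m"] assms(3)[of x] m by (simp add: ln_div)
  qed (use assms in auto)
  also have "\<dots> = ln ?m"
    using m unfolding mean_add mean_cmult by (simp add: mean_const assms)
  finally show ?thesis .
qed

section \<open>Smoothing\<close>

text \<open>A point at Hamming distance \<open>k\<close> from \<open>x\<close> gets weight
  \<open>(1 + r) ^ (n - k) * r ^ k\<close>: a soft form of enlarging a set to a Hamming
  neighbourhood.\<close>

definition smooth :: "nat \<Rightarrow> 'a::finite \<Rightarrow> real \<Rightarrow> ((nat \<Rightarrow> 'a) \<Rightarrow> real) \<Rightarrow> (nat \<Rightarrow> 'a) \<Rightarrow> real" where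
  "smooth n d r h x = (\<Sum>a\<in>seqs n d. (\<Prod>i<n. of_bool (x i = a i) + r) * h a)"

lemma smooth_0 [simp]: "smooth 0 d r h x = h (\<lambda>_. d)"
  by (simp add: smooth_def seqs_0)

lemma smooth_Suc:
  "smooth (Suc n) d r h (x(n := b))
     = (\<Sum>a\<in>UNIV. (of_bool (b = a) + r) * smooth n d r (\<lambda>y. h (y(n := a))) x)"
  by (simp add: smooth_def sum_seqs_Suc sum_distrib_left mult_ac cong: prod.cong_simp)

lemma smooth_nonneg:
  assumes "r \<ge> 0" "\<And>y. h y \<ge> 0"
  shows "smooth n d r h x \<ge> 0"
  unfolding smooth_def using assms by (intro sum_nonneg mult_nonneg_nonneg prod_nonneg) auto

text \<open>Every kernel entry is at least \<open>r ^ n\<close>, so one point where \<open>h\<close>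
  does not vanish contributes at every \<open>x\<close>; the positive mean supplies such a
  point.\<close>

lemma smooth_pos:
  assumes "r > 0" "\<And>y. h y \<ge> 0" "mean n d p h > 0"
  shows "smooth n d r h x > 0"
proof -
  obtain a where a: "a \<in> seqs n d" "h a \<noteq> 0"
  proof (rule ccontr)
    assume "\<not> thesis"
    then have "mean n d p h = mean n d p (\<lambda>_. 0 * 0)"
      using that by (intro mean_cong) auto
    with assms(3) show False by (simp only: mean_cmult)
  qed
  show ?thesis
    unfolding smooth_def
  proof (rule sum_pos2[OF _ a(1)])
    show "0 < (\<Prod>i<n. of_bool (x i = a i) + r) * h a"
      using a assms(1) assms(2)[of a] by (intro mult_pos_pos prod_pos) (auto simp: add_nonneg_pos)
    show "0 \<le> (\<Prod>i<n. of_bool (x i = b i) + r) * h b" for b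
      using assms(1) assms(2)[of b] by (intro mult_nonneg_nonneg prod_nonneg) auto
  qed simp
qed

text \<open>Both bounds keep one term of the recursion for the last coordinate: the matching letter
  has coefficient \<open>1 + r\<close>, and every letter has coefficient at least
  \<open>r\<close>.\<close>

lemma smooth_ge_section:
  assumes "r \<ge> 0" "\<And>y. h y \<ge> 0"
  shows "smooth n d r (\<lambda>y. h (y(n := b))) x \<le> smooth (Suc n) d r h (x(n := b))"
    and "r * smooth n d r (\<lambda>y. h (y(n := a))) x \<le> smooth (Suc n) d r h (x(n := b))"
proof -
  let ?t = "\<lambda>a. (of_bool (b = a) + r) * smooth n d r (\<lambda>y. h (y(n := a))) x"
  have s: "smooth n d r (\<lambda>y. h (y(n := a))) x \<ge> 0" for a
    by (intro smooth_nonneg assms)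
  have t: "?t a \<le> smooth (Suc n) d r h (x(n := b))" for a
    unfolding smooth_Suc by (rule member_le_sum) (use s assms in auto)
  show "r * smooth n d r (\<lambda>y. h (y(n := a))) x \<le> smooth (Suc n) d r h (x(n := b))"
    using t[of a] s[of a] by (cases "b = a") (auto simp: distrib_right)
  show "smooth n d r (\<lambda>y. h (y(n := b))) x \<le> smooth (Suc n) d r h (x(n := b))"
    using t[of b] s[of b] assms(1) by (auto simp: distrib_right intro: order_trans[rotated])
qed

lemma smooth_one_ge:
  assumes "r \<ge> 0" "x \<in> seqs n d"
  shows "smooth n d r (\<lambda>_. 1) x \<ge> 1"
proof -
  have "(\<Prod>i<n. of_bool (x i = x i) + r) * 1 \<le> smooth n d r (\<lambda>_. 1) x"
    unfolding smooth_def by (rule member_le_sum) (use assms in \<open>auto intro!: prod_nonneg\<close>)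
  moreover have "(1::real) \<le> (\<Prod>i<n. of_bool (x i = x i) + r)"
    using assms(1) by (intro prod_ge_1) auto
  ultimately show ?thesis by simp
qed

text \<open>The left side is a concave quadratic in \<open>s\<close> with its maximum at
  \<open>s = (1 + L) / (2 * L)\<close>. The maximum is the loss per coordinate in
  \<open>smooth_reverse\<close>.\<close>

lemma reverse_smoothing_step:
  fixes s L :: real
  assumes "L > 0"
  shows "s * (1 + L * (1 - s)) \<le> (1 + L)\<^sup>2 / (4 * L)"
proof -
  have "0 \<le> (1 + L - 2 * L * s)\<^sup>2" by simp
  then have "s * (1 + L * (1 - s)) * (4 * L) \<le> (1 + L)\<^sup>2"
    by (simp add: power2_eq_square algebra_simps)
  then show ?thesis using assms by (simp add: field_simps)
qed

text \<open>Smoothing spreads any nonnegligible \<open>h\<close> so much that it is rarely small. In the induction step, with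
  \<open>v\<close> the ratio of the mass of a section to the largest one, the section contributes at most the minimum of
  \<open>1 / v\<close> (compare with itself) and \<open>L\<close> (compare with the largest section), which is below
  \<open>1 + L * (1 - v)\<close>.\<close>

lemma smooth_reverse:
  assumes p: "\<And>a. p a \<ge> 0" "sum p UNIV = 1"
    and r: "0 < r" and q: "0 < q" "q \<le> 1"
    and h: "\<And>x. 0 \<le> h x" "\<And>x. h x \<le> 1"
    and L: "L = r powr - q"
  shows "mean n d p (\<lambda>x. smooth n d r h x powr - q) * mean n d p h \<le> ((1 + L)\<^sup>2 / (4 * L)) ^ n"
  using h
proof (induction n arbitrary: h)
  case 0
  show ?case
  proof (cases "h (\<lambda>_. d) = 0")
    case False
    then have "h (\<lambda>_. d) > 0" using 0(1)[of "\<lambda>_. d"] by simp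
    then have "h (\<lambda>_. d) powr - q * h (\<lambda>_. d) = h (\<lambda>_. d) powr (1 - q)"
      by (simp add: powr_diff powr_minus field_simps)
    also have "\<dots> \<le> 1"
      using 0(1,2)[of "\<lambda>_. d"] q by (intro powr_le1) auto
    finally show ?thesis by simp
  qed simp
next
  case (Suc n)
  have Lpos: "L > 0" using L r by simp
  let ?c = "(1 + L)\<^sup>2 / (4 * L)"
  define M where "M = (\<lambda>a. mean n d p (\<lambda>x. h (x(n := a))))"
  define W where "W = (\<lambda>a. mean n d p (\<lambda>x. smooth n d r (\<lambda>y. h (y(n := a))) x powr - q))"
  define G where "G = (\<lambda>a. mean n d p (\<lambda>x. smooth (Suc n) d r h (x(n := a)) powr - q))"
  have WM: "W a * M a \<le> ?c ^ n" for a
    unfolding W_def M_def by (rule Suc.IH) (use Suc.prems in auto)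
  have M0: "M a \<ge> 0" for a
    unfolding M_def by (intro mean_nonneg p Suc.prems)
  define m where "m = Max (range M)"
  have "m \<in> range M" unfolding m_def by (intro Max_in) auto
  then obtain b where b: "m = M b" by auto
  have Mm: "M a \<le> m" for a unfolding m_def by (intro Max_ge) auto
  have S: "mean (Suc n) d p h = (\<Sum>a\<in>UNIV. p a * M a)"
    unfolding mean_Suc M_def ..
  show ?case
  proof (cases "m = 0")
    case True
    then have "M a = 0" for a using M0[of a] Mm[of a] by simp
    then have "mean (Suc n) d p h = 0" by (simp add: S)
    then show ?thesis using Lpos by simp
  next
    case False
    then have m: "m > 0" using M0[of b] b by simp
    have pos: "smooth n d r (\<lambda>y. h (y(n := a))) x > 0" if "M a > 0" for a x
      using that r Suc.prems unfolding M_def by (intro smooth_pos) auto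
    have G: "G a \<le> ?c ^ n / m * (1 + L * (1 - M a / m))" for a
    proof (cases "M a * L \<le> m")
      case True
      have "G a \<le> mean n d p (\<lambda>x. L * smooth n d r (\<lambda>y. h (y(n := b))) x powr - q)"
        unfolding G_def
      proof (intro mean_mono p)
        fix x
        have "smooth (Suc n) d r h (x(n := a)) powr - q
            \<le> (r * smooth n d r (\<lambda>y. h (y(n := b))) x) powr - q"
          using smooth_ge_section(2)[of r h n d b x a] pos[of b x] m b r q Suc.prems
          by (intro powr_mono2') auto
        also have "\<dots> = L * smooth n d r (\<lambda>y. h (y(n := b))) x powr - q"
          using r pos[of b x] m b by (simp add: L powr_mult)
        finally show "smooth (Suc n) d r h (x(n := a)) powr - q
            \<le> L * smooth n d r (\<lambda>y. h (y(n := b))) x powr - q" .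
      qed
      also have "\<dots> = L * W b" by (simp add: mean_cmult W_def)
      also have "\<dots> \<le> L * (?c ^ n / m)"
        using WM[of b] m b Lpos by (intro mult_left_mono) (auto simp: pos_le_divide_eq)
      also have "\<dots> = ?c ^ n / m * L" by simp
      also have "\<dots> \<le> ?c ^ n / m * (1 + L * (1 - M a / m))"
        using True m Lpos by (intro mult_left_mono) (auto simp: field_simps)
      finally show ?thesis .
    next
      case False
      then have Ma: "M a > 0" using m Lpos M0[of a] by (cases "M a = 0") auto
      have "G a \<le> W a"
        unfolding G_def W_def
      proof (intro mean_mono p)
        fix x
        show "smooth (Suc n) d r h (x(n := a)) powr - q
            \<le> smooth n d r (\<lambda>y. h (y(n := a))) x powr - q"
          using smooth_ge_section(1)[of r h n d a x] pos[of a x] Ma r q Suc.prems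
          by (intro powr_mono2') auto
      qed
      also have "W a \<le> ?c ^ n / M a"
        using WM[of a] Ma by (simp add: pos_le_divide_eq)
      also have "\<dots> = ?c ^ n * (1 / M a)" by simp
      also have "\<dots> \<le> ?c ^ n * ((1 + L * (1 - M a / m)) / m)"
      proof (rule mult_left_mono)
        \<comment> \<open>With \<open>v = M a / m\<close> this is
          \<open>(1 - v) * (v * L - 1) \<ge> 0\<close>, which rearranges to
          \<open>1 / v \<le> 1 + L * (1 - v)\<close>: the convex function \<open>1 / v\<close> lies
          below its chord between \<open>1 / L\<close> and 1.\<close>
        have "0 \<le> (m - M a) * (M a * L - m)"
          using False Mm[of a] by (intro mult_nonneg_nonneg) auto
        then show "1 / M a \<le> (1 + L * (1 - M a / m)) / m"
          using Ma m by (simp add: field_simps power2_eq_square)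
      qed (use Lpos in auto)
      finally show ?thesis by simp
    qed
    \<comment> \<open>The bound on \<open>G a\<close> is affine in \<open>M a\<close>, so averaging
      over the last letter leaves only the mean ratio \<open>s\<close>.\<close>
    define s where "s = mean (Suc n) d p h / m"
    have "mean (Suc n) d p (\<lambda>x. smooth (Suc n) d r h x powr - q) = (\<Sum>a\<in>UNIV. p a * G a)"
      unfolding mean_Suc G_def ..
    also have "\<dots> \<le> (\<Sum>a\<in>UNIV. p a * (?c ^ n / m * (1 + L * (1 - M a / m))))"
      by (intro sum_mono mult_left_mono G p)
    also have "\<dots> = (\<Sum>a\<in>UNIV. ?c ^ n / m * ((1 + L) * p a - L / m * (p a * M a)))"
      by (intro sum.cong refl) (simp add: algebra_simps)
    also have "\<dots> = ?c ^ n / m * ((1 + L) * sum p UNIV - L / m * (\<Sum>a\<in>UNIV. p a * M a))"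
      by (simp only: sum_subtractf flip: sum_distrib_left)
    also have "\<dots> = ?c ^ n / m * (1 + L * (1 - s))"
      unfolding S[symmetric] s_def p(2) by (simp add: algebra_simps)
    finally have "mean (Suc n) d p (\<lambda>x. smooth (Suc n) d r h x powr - q) * mean (Suc n) d p h
        \<le> ?c ^ n / m * (1 + L * (1 - s)) * mean (Suc n) d p h"
      by (intro mult_right_mono mean_nonneg p Suc.prems)
    also have "\<dots> = ?c ^ n * (s * (1 + L * (1 - s)))"
      using m by (simp add: s_def)
    also have "\<dots> \<le> ?c ^ n * ?c"
      using Lpos by (intro mult_left_mono reverse_smoothing_step) auto
    finally show ?thesis by (simp only: power_Suc2)
  qed
qed

text \<open>Positivity of \<open>Q\<close> makes \<open>step\<close> available with \<open>K\<close> close to 1, so that smoothing is almost free under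
  \<open>Q\<^sup>n\<close>.\<close>

lemma smooth_pullback:
  fixes Q :: "'u::finite \<times> 'v::finite \<Rightarrow> real"
  assumes Q: "\<And>z. Q z \<ge> 0" and r: "r \<ge> 0"
    and step: "\<And>a' b'. (\<Sum>(a, b)\<in>UNIV. Q (a, b) * ((of_bool (a = a') + r) * (of_bool (b = b') + r)))
        \<le> K * Q (a', b')"
    and h: "\<And>x. h1 x \<ge> 0" "\<And>x. h2 x \<ge> 0"
  shows "mean n (d1, d2) Q (\<lambda>w. smooth n d1 r h1 (\<lambda>i. fst (w i)) * smooth n d2 r h2 (\<lambda>i. snd (w i)))
    \<le> K ^ n * mean n (d1, d2) Q (\<lambda>w. h1 (\<lambda>i. fst (w i)) * h2 (\<lambda>i. snd (w i)))"
  using h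
proof (induction n arbitrary: h1 h2)
  case (Suc n)
  \<comment> \<open>Multiplying the induction hypothesis by \<open>K * Q (a, b)\<close> needs this
    factor to be nonnegative; \<open>step\<close> rules out a negative \<open>K\<close> as soon as
    some \<open>Q z\<close> is positive.\<close>
  have K: "K \<ge> 0 \<or> (\<forall>z. Q z = 0)"
  proof (rule ccontr)
    assume "\<not> ?thesis"
    then obtain a b where ab: "Q (a, b) > 0" "K < 0" using Q
      by (metis less_eq_real_def not_le surj_pair)
    have "0 \<le> (\<Sum>(a1, b1)\<in>UNIV. Q (a1, b1) * ((of_bool (a1 = a) + r) * (of_bool (b1 = b) + r)))"
      using Q r by (intro sum_nonneg) (auto intro!: mult_nonneg_nonneg)
    also have "\<dots> \<le> K * Q (a, b)" by (rule step)
    also have "\<dots> < 0" using ab by (simp add: mult_neg_pos)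
    finally show False by simp
  qed
  define A where "A = (\<lambda>a b. mean n (d1, d2) Q (\<lambda>w. smooth n d1 r (\<lambda>y. h1 (y(n := a))) (\<lambda>i. fst (w i))
      * smooth n d2 r (\<lambda>y. h2 (y(n := b))) (\<lambda>i. snd (w i))))"
  define B where "B = (\<lambda>a b. mean n (d1, d2) Q (\<lambda>w. h1 ((\<lambda>i. fst (w i))(n := a)) * h2 ((\<lambda>i. snd (w i))(n := b))))"
  have AB: "A a b \<le> K ^ n * B a b" for a b
    unfolding A_def B_def by (rule Suc.IH) (use Suc.prems in auto)
  have A0: "A a b \<ge> 0" for a b
    unfolding A_def by (intro mean_nonneg Q mult_nonneg_nonneg smooth_nonneg r Suc.prems)
  have upd: "(\<lambda>i. fst ((w(n := z)) i)) = (\<lambda>i. fst (w i))(n := fst z)"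
    "(\<lambda>i. snd ((w(n := z)) i)) = (\<lambda>i. snd (w i))(n := snd z)" for w :: "nat \<Rightarrow> 'u \<times> 'v" and z
    by auto
  let ?k1 = "\<lambda>z a. of_bool (fst z = a) + r" and ?k2 = "\<lambda>z b. of_bool (snd z = b) + r"
  have "mean (Suc n) (d1, d2) Q (\<lambda>w. smooth (Suc n) d1 r h1 (\<lambda>i. fst (w i)) * smooth (Suc n) d2 r h2 (\<lambda>i. snd (w i)))
     = (\<Sum>z\<in>UNIV. Q z * mean n (d1, d2) Q (\<lambda>w. \<Sum>a\<in>UNIV. \<Sum>b\<in>UNIV. (?k1 z a * ?k2 z b) *
          (smooth n d1 r (\<lambda>y. h1 (y(n := a))) (\<lambda>i. fst (w i)) * smooth n d2 r (\<lambda>y. h2 (y(n := b))) (\<lambda>i. snd (w i)))))"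
    unfolding mean_Suc upd smooth_Suc sum_product
    by (rule sum.cong[OF refl], rule arg_cong[of _ _ "(*) _"], rule mean_cong,
        rule sum.cong[OF refl], rule sum.cong[OF refl]) (simp only: mult_ac)
  also have "\<dots> = (\<Sum>z\<in>UNIV. \<Sum>a\<in>UNIV. \<Sum>b\<in>UNIV. Q z * (?k1 z a * ?k2 z b) * A a b)"
    unfolding mean_sum mean_cmult A_def sum_distrib_left by (simp only: mult_ac)
  also have "\<dots> = (\<Sum>a\<in>UNIV. \<Sum>b\<in>UNIV. (\<Sum>z\<in>UNIV. Q z * (?k1 z a * ?k2 z b)) * A a b)"
    by (subst sum.swap, rule sum.cong[OF refl], subst sum.swap) (simp add: sum_distrib_right)
  also have "\<dots> \<le> (\<Sum>a\<in>UNIV. \<Sum>b\<in>UNIV. (K * Q (a, b)) * A a b)"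
    using step by (intro sum_mono mult_right_mono A0) (simp add: case_prod_unfold)
  also have "\<dots> \<le> (\<Sum>a\<in>UNIV. \<Sum>b\<in>UNIV. (K * Q (a, b)) * (K ^ n * B a b))"
    using K Q by (intro sum_mono mult_left_mono AB) auto
  also have "\<dots> = K ^ Suc n * (\<Sum>z\<in>UNIV. Q z * B (fst z) (snd z))"
    by (simp add: sum_distrib_left sum.cartesian_product case_prod_unfold mult_ac)
  also have "(\<Sum>z\<in>UNIV. Q z * B (fst z) (snd z))
      = mean (Suc n) (d1, d2) Q (\<lambda>w. h1 (\<lambda>i. fst (w i)) * h2 (\<lambda>i. snd (w i)))"
    unfolding mean_Suc upd B_def ..
  finally show ?case .
qed simp

section \<open>Types\<close>

definition freq :: "nat \<Rightarrow> (nat \<Rightarrow> 'a) \<Rightarrow> 'a \<Rightarrow> real" where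
  "freq n x a = (\<Sum>i<n. of_bool (x i = a)) / real n"

lemma freq_nonneg: "freq n x a \<ge> 0"
  by (auto simp: freq_def intro!: divide_nonneg_nonneg sum_nonneg)

lemma sum_freq_mult:
  fixes x :: "nat \<Rightarrow> 'a::finite"
  shows "(\<Sum>a\<in>UNIV. freq n x a * f a) = (\<Sum>i<n. f (x i)) / real n"
proof -
  have "(\<Sum>a\<in>UNIV. freq n x a * f a) = (\<Sum>a\<in>UNIV. \<Sum>i<n. of_bool (x i = a) * f a) / real n"
    by (simp add: freq_def sum_distrib_right sum_divide_distrib)
  also have "(\<Sum>a\<in>UNIV. \<Sum>i<n. of_bool (x i = a) * f a) = (\<Sum>i<n. \<Sum>a\<in>UNIV. of_bool (x i = a) * f a)"
    by (rule sum.swap)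
  finally show ?thesis by simp
qed

lemma sum_freq: "n > 0 \<Longrightarrow> sum (freq n x) (UNIV :: 'a::finite set) = 1"
  using sum_freq_mult[of n x "\<lambda>_. 1"] by simp

text \<open>The marginals of a joint type are the types of the projected sequences. Separate bounds
  for the two terminals can therefore be used under one tilted joint law.\<close>

lemma freq_image:
  fixes x :: "nat \<Rightarrow> 'a::finite"
  shows "freq n (\<lambda>i. \<pi> (x i)) b = (\<Sum>a | \<pi> a = b. freq n x a)"
proof -
  have "(\<Sum>a | \<pi> a = b. freq n x a) = (\<Sum>a\<in>UNIV. freq n x a * of_bool (\<pi> a = b))"
    by (simp add: of_bool_def if_distrib sum.If_cases)
  then show ?thesis by (simp add: sum_freq_mult) (simp add: freq_def)
qed

text \<open>Each term is the probability of \<open>x\<close> under the product law of its own type.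
  Enlarging it to a sum over all types gives total mass 1 per type, and there are at most
  \<open>(n + 1) ^ CARD('a)\<close> types.\<close>

lemma sum_freq_prod_le:
  fixes d :: "'a::finite"
  shows "(\<Sum>x\<in>seqs n d. \<Prod>i<n. freq n x (x i)) \<le> real (n + 1) ^ CARD('a)"
proof (cases "n = 0")
  case False
  let ?T = "freq n ` seqs n d"
  have "?T \<subseteq> (\<lambda>f a. real (f a) / real n) ` (UNIV \<rightarrow>\<^sub>E {..n})"
  proof safe
    fix x
    have "freq n x = (\<lambda>a. real (card {i. i < n \<and> x i = a}) / real n)"
      by (auto simp: freq_def of_bool_def sum.If_cases fun_eq_iff Int_def)
    moreover have "card {i. i < n \<and> x i = a} \<le> n" for a
      using card_mono[of "{..<n}" "{i. i < n \<and> x i = a}"] by auto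
    ultimately show "freq n x \<in> (\<lambda>f a. real (f a) / real n) ` (UNIV \<rightarrow>\<^sub>E {..n})"
      by (intro image_eqI[of _ _ "\<lambda>a. card {i. i < n \<and> x i = a}"]) auto
  qed
  then have "card ?T \<le> card ((\<lambda>f a. real (f a) / real n) ` ((UNIV :: 'a set) \<rightarrow>\<^sub>E {..n}))"
    by (intro card_mono finite_imageI finite_PiE) auto
  also have "\<dots> \<le> card ((UNIV :: 'a set) \<rightarrow>\<^sub>E {..n})"
    by (intro card_image_le finite_PiE) auto
  also have "\<dots> = (n + 1) ^ CARD('a)"
    by (simp add: card_PiE)
  finally have card: "card ?T \<le> (n + 1) ^ CARD('a)" .
  have "(\<Sum>x\<in>seqs n d. \<Prod>i<n. freq n x (x i)) \<le> (\<Sum>x\<in>seqs n d. \<Sum>t\<in>?T. \<Prod>i<n. t (x i))"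
  proof (rule sum_mono)
    fix x assume "x \<in> seqs n d"
    then show "(\<Prod>i<n. freq n x (x i)) \<le> (\<Sum>t\<in>?T. \<Prod>i<n. t (x i))"
      by (intro member_le_sum[of "freq n x" _ "\<lambda>t. \<Prod>i<n. t (x i)"])
        (auto intro!: prod_nonneg freq_nonneg)
  qed
  also have "\<dots> = (\<Sum>t\<in>?T. \<Sum>x\<in>seqs n d. \<Prod>i<n. t (x i))"
    by (rule sum.swap)
  also have "\<dots> = (\<Sum>t\<in>?T. 1)"
    using False by (intro sum.cong refl) (auto simp: sum_seqs_prod[of "\<lambda>_. freq n _"] sum_freq)
  also have "\<dots> \<le> real ((n + 1) ^ CARD('a))"
    using card by (simp only: sum_constant mult_1_right of_nat_le_iff)
  finally show ?thesis by simp
qed (simp add: seqs_0)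

text \<open>Gibbs' variational inequality, tilting \<open>Q\<^sup>n\<close> to the product law of the type of \<open>w0\<close>; on \<open>w0\<close> itself
  the density between the two laws equals the exponential of their relative entropy.\<close>

lemma type_lower_bound:
  fixes Q :: "'u::finite \<times> 'v::finite \<Rightarrow> real"
  assumes Q: "\<And>z. Q z > 0" and n: "n > 0"
    and F: "\<And>x. x \<in> seqs n d1 \<Longrightarrow> F x > 0" and G: "\<And>x. x \<in> seqs n d2 \<Longrightarrow> G x > 0"
    and f: "- \<kappa>1 \<le> mean n d1 (freq n (\<lambda>i. fst (w0 i))) (\<lambda>x. ln (F x))"
    and g: "- \<kappa>2 \<le> mean n d2 (freq n (\<lambda>i. snd (w0 i))) (\<lambda>x. ln (G x))"
  shows "(\<Prod>i<n. Q (w0 i)) \<le> (\<Prod>i<n. freq n w0 (w0 i)) *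
    (exp (\<kappa>1 + \<kappa>2) * mean n (d1, d2) Q (\<lambda>w. F (\<lambda>i. fst (w i)) * G (\<lambda>i. snd (w i))))"
proof -
  define R where "R = freq n w0"
  \<comment> \<open>The density of \<open>Q\<close> against \<open>R\<close>. The default 1 keeps
    \<open>t\<close> positive off the support of \<open>R\<close>, where
    \<open>R z * t z = 0 \<le> Q z\<close>.\<close>
  define t where "t = (\<lambda>z. if R z = 0 then 1 else Q z / R z)"
  let ?d = "(d1, d2)"
  have R: "\<And>z. R z \<ge> 0" "sum R UNIV = 1"
    using n by (simp_all add: R_def freq_nonneg sum_freq)
  have t: "t z > 0" for z using Q[of z] R(1)[of z] by (auto simp: t_def)
  have Rt: "R z * t z \<le> Q z" for z using Q[of z] by (auto simp: t_def)
  have fs: "(\<lambda>i. fst (w i)) \<in> seqs n d1" "(\<lambda>i. snd (w i)) \<in> seqs n d2" if "w \<in> seqs n ?d" for w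
    using that by (auto simp: seqs_def)
  define FG where "FG = (\<lambda>w :: nat \<Rightarrow> 'u \<times> 'v. F (\<lambda>i. fst (w i)) * G (\<lambda>i. snd (w i)))"
  have FG: "FG w > 0" if "w \<in> seqs n ?d" for w
    unfolding FG_def using fs[OF that] F G by simp
  let ?S = "\<Sum>i<n. ln (t (w0 i))"
  have "mean n ?d R (\<lambda>w. ln ((\<Prod>i<n. t (w i)) * FG w))
      = mean n ?d R (\<lambda>w. (\<Sum>i<n. ln (t (w i))) + (ln (F (\<lambda>i. fst (w i))) + ln (G (\<lambda>i. snd (w i)))))"
  proof (rule mean_cong)
    fix w assume w: "w \<in> seqs n ?d"
    have "(\<Prod>i<n. t (w i)) > 0" using t by (simp add: prod_pos)
    then show "ln ((\<Prod>i<n. t (w i)) * FG w)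
        = (\<Sum>i<n. ln (t (w i))) + (ln (F (\<lambda>i. fst (w i))) + ln (G (\<lambda>i. snd (w i))))"
      using t F[OF fs(1)[OF w]] G[OF fs(2)[OF w]]
      by (simp add: FG_def ln_mult ln_prod less_imp_neq[symmetric])
  qed
  also have "\<dots> = real n * (\<Sum>z\<in>UNIV. R z * ln (t z))
     + (mean n d1 (freq n (\<lambda>i. fst (w0 i))) (\<lambda>x. ln (F x)) + mean n d2 (freq n (\<lambda>i. snd (w0 i))) (\<lambda>x. ln (G x)))"
    using mean_image[of n ?d R "\<lambda>x. ln (F x)" fst] mean_image[of n ?d R "\<lambda>x. ln (G x)" snd]
    mean_sum_coords[OF R(2), of n ?d "\<lambda>z. ln (t z)"]
    by (simp add: mean_add freq_image[abs_def] R_def)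
  also have "real n * (\<Sum>z\<in>UNIV. R z * ln (t z)) = ?S"
    using n by (simp add: R_def sum_freq_mult)
  finally have "?S - (\<kappa>1 + \<kappa>2) \<le> mean n ?d R (\<lambda>w. ln ((\<Prod>i<n. t (w i)) * FG w))"
    using f g by simp
  also have "\<dots> \<le> ln (mean n ?d R (\<lambda>w. (\<Prod>i<n. t (w i)) * FG w))"
    using FG t by (intro mean_ln_le R mult_pos_pos prod_pos) auto
  finally have "exp (?S - (\<kappa>1 + \<kappa>2)) \<le> mean n ?d R (\<lambda>w. (\<Prod>i<n. t (w i)) * FG w)"
    using FG by (subst (asm) ln_ge_iff) (auto simp: t intro!: mean_pos R mult_pos_pos prod_pos)
  also have "\<dots> = (\<Sum>w\<in>seqs n ?d. (\<Prod>i<n. R (w i) * t (w i)) * FG w)"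
    by (simp add: mean_def prod.distrib mult_ac)
  also have "\<dots> \<le> mean n ?d Q FG"
    unfolding mean_def
    by (intro sum_mono mult_right_mono prod_mono) (auto simp: FG R(1) Rt t less_imp_le)
  finally have *: "exp ?S \<le> exp (\<kappa>1 + \<kappa>2) * mean n ?d Q FG"
    by (simp add: exp_diff field_simps)
  \<comment> \<open>Letters occurring in \<open>w0\<close> have positive frequency, so along
    \<open>w0\<close> the default value of \<open>t\<close> is never met.\<close>
  have "(\<Prod>i<n. Q (w0 i)) = (\<Prod>i<n. R (w0 i) * t (w0 i))"
  proof (intro prod.cong refl)
    fix i assume "i \<in> {..<n}"
    then have "(\<Sum>j<n. of_bool (w0 j = w0 i)) > (0::real)"
      by (intro sum_pos2[of _ i]) auto
    then have "R (w0 i) > 0"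
      unfolding R_def freq_def using n by (rule divide_pos_pos[OF _ of_nat_0_less_iff[THEN iffD2]])
    then show "Q (w0 i) = R (w0 i) * t (w0 i)" by (simp add: t_def)
  qed
  also have "\<dots> = (\<Prod>i<n. R (w0 i)) * exp ?S"
    using t by (simp add: prod.distrib exp_sum)
  also have "\<dots> \<le> (\<Prod>i<n. R (w0 i)) * (exp (\<kappa>1 + \<kappa>2) * mean n ?d Q FG)"
    using * R by (intro mult_left_mono prod_nonneg) auto
  finally show ?thesis by (simp add: R_def FG_def)
qed

section \<open>Typical sequences against rectangles\<close>

text \<open>Only an upper bound on the frequencies is imposed: it makes the product law of the type of \<open>x\<close>
  at most \<open>(1 + \<delta>)\<^sup>n\<close> times the product law of \<open>p\<close>.\<close>

definition typical :: "('a \<Rightarrow> real) \<Rightarrow> real \<Rightarrow> nat \<Rightarrow> (nat \<Rightarrow> 'a) \<Rightarrow> bool" where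
  "typical p \<delta> n x \<longleftrightarrow> (\<forall>a. freq n x a \<le> (1 + \<delta>) * p a)"

text \<open>The logarithm vanishes to second order at \<open>q = 0\<close>.\<close>

lemma tilt_exists:
  fixes r \<xi> :: real
  assumes "\<xi> > 0" "0 < r" "r < 1"
  shows "\<exists>q. 0 < q \<and> q \<le> 1 \<and> ln ((1 + r powr - q)\<^sup>2 / (4 * r powr - q)) \<le> q * \<xi>"
proof -
  define b where "b = - ln r"
  have b: "b > 0" using assms by (simp add: b_def)
  have "((\<lambda>q. ln ((1 + exp (b * q))\<^sup>2 / (4 * exp (b * q))) / q) \<longlongrightarrow> 0) (at_right 0)"
    using b by real_asymp
  then have "\<forall>\<^sub>F q in at_right 0. ln ((1 + exp (b * q))\<^sup>2 / (4 * exp (b * q))) / q < \<xi>"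
    using assms(1) by (rule order_tendstoD)
  moreover have "\<forall>\<^sub>F q in at_right (0::real). 0 < q \<and> q < 1"
    by (simp add: eventually_at_right_less eventually_conj_iff eventually_at_right_real)
       (rule eventually_at_rightI[of 0 1]; simp)
  ultimately have "\<forall>\<^sub>F q in at_right 0. 0 < q \<and> q < 1 \<and> ln ((1 + exp (b * q))\<^sup>2 / (4 * exp (b * q))) / q < \<xi>"
    by eventually_elim simp
  then obtain q where q: "0 < q" "q < 1" "ln ((1 + exp (b * q))\<^sup>2 / (4 * exp (b * q))) / q < \<xi>"
    using eventually_happens trivial_limit_at_right_real by blast
  have "exp (b * q) = r powr - q"
    using assms by (simp add: powr_def b_def mult.commute)
  with q show ?thesis
    by (intro exI[of _ q]) (simp add: pos_divide_less_eq mult.commute)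
qed

text \<open>\<open>smooth_reverse\<close> controls the mean of
  \<open>smooth n d r h x powr - q\<close> under \<open>p\<close>; typicality of \<open>y\<close>
  carries it to the type law at cost \<open>(1 + \<delta>) ^ n\<close>, and Jensen's inequality
  turns it into a bound on the mean logarithm. Because of the division by \<open>q\<close>, the
  bound is useful only for \<open>\<zeta>\<close> small compared with \<open>q\<close>.\<close>

lemma mean_ln_smooth_ge:
  assumes p: "\<And>a. p a \<ge> 0" "sum p UNIV = 1"
    and r: "0 < r" and q: "0 < q" "q \<le> 1"
    and h: "\<And>x. 0 \<le> h x" "\<And>x. h x \<le> 1"
    and L: "ln ((1 + r powr - q)\<^sup>2 / (4 * r powr - q)) \<le> \<zeta>"
    and \<delta>: "\<delta> \<ge> 0" and n: "n > 0"
    and y: "typical p \<delta> n y"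
    and mean_h: "mean n d p h \<ge> exp (- \<eta> * real n)"
  shows "- (n * (\<delta> + \<zeta> + \<eta>) / q) \<le> mean n d (freq n y) (\<lambda>x. ln (smooth n d r h x))"
proof -
  let ?R = "freq n y" and ?c = "(1 + r powr - q)\<^sup>2 / (4 * r powr - q)"
  have R: "\<And>a. ?R a \<ge> 0" "sum ?R UNIV = 1"
    using n by (simp_all add: freq_nonneg sum_freq)
  have F: "smooth n d r h x > 0" for x
    using mean_h r h by (intro smooth_pos[of _ _ _ _ p]) (auto intro: less_le_trans[rotated])
  have "r powr - q > 0" using r by simp
  then have c: "?c > 0" by (intro divide_pos_pos zero_less_power) linarith+
  have "mean n d p (\<lambda>x. smooth n d r h x powr - q) * exp (- \<eta> * real n)
      \<le> mean n d p (\<lambda>x. smooth n d r h x powr - q) * mean n d p h"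
    by (intro mult_left_mono mean_h mean_nonneg p) simp
  also have "\<dots> \<le> ?c ^ n"
    by (rule smooth_reverse) (use assms in auto)
  also have "?c ^ n \<le> exp (\<zeta> * n)"
  proof -
    have "?c ^ n = exp (ln ?c * n)"
      using c by (simp only: exp_of_nat2_mult exp_ln)
    also have "\<dots> \<le> exp (\<zeta> * n)" using L by (simp add: mult_right_mono)
    finally show ?thesis .
  qed
  finally have rev: "mean n d p (\<lambda>x. smooth n d r h x powr - q) \<le> exp (\<zeta> * n) * exp (\<eta> * n)"
    by (simp add: exp_minus field_simps)
  have "mean n d ?R (\<lambda>x. ln (smooth n d r h x powr - q)) \<le> ln (mean n d ?R (\<lambda>x. smooth n d r h x powr - q))"
    by (intro mean_ln_le R) (use F in \<open>auto simp: less_imp_neq[symmetric]\<close>)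
  also have "\<dots> \<le> ln (exp (\<delta> * n) * (exp (\<zeta> * n) * exp (\<eta> * n)))"
  proof (rule ln_mono)
    show "0 < mean n d ?R (\<lambda>x. smooth n d r h x powr - q)"
      by (intro mean_pos R) (use F in \<open>auto simp: less_imp_neq[symmetric]\<close>)
    have "mean n d ?R (\<lambda>x. smooth n d r h x powr - q) \<le> (1 + \<delta>) ^ n * mean n d p (\<lambda>x. smooth n d r h x powr - q)"
      using y by (intro mean_change_weights R) (auto simp: typical_def)
    also have "\<dots> \<le> exp (\<delta> * n) * (exp (\<zeta> * n) * exp (\<eta> * n))"
    proof (intro mult_mono rev mean_nonneg p)
      have "(1 + \<delta>) ^ n \<le> exp \<delta> ^ n"
        using \<delta> by (intro power_mono exp_ge_add_one_self) auto
      then show "(1 + \<delta>) ^ n \<le> exp (\<delta> * n)" by (simp only: exp_of_nat2_mult)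
    qed auto
    finally show "mean n d ?R (\<lambda>x. smooth n d r h x powr - q) \<le> exp (\<delta> * n) * (exp (\<zeta> * n) * exp (\<eta> * n))" .
  qed
  also have "\<dots> = n * (\<delta> + \<zeta> + \<eta>)"
    by (simp add: algebra_simps flip: exp_add)
  also have "mean n d ?R (\<lambda>x. ln (smooth n d r h x powr - q)) = - q * mean n d ?R (\<lambda>x. ln (smooth n d r h x))"
    unfolding mean_cmult[symmetric] by (rule mean_cong) (simp add: ln_powr)
  finally have "- q * mean n d ?R (\<lambda>x. ln (smooth n d r h x)) \<le> n * (\<delta> + \<zeta> + \<eta>)" .
  then show ?thesis
    using q by (simp add: field_simps)
qed

text \<open>Each \<open>w\<close> in \<open>T\<close> is compared with the smoothed product through
  its own type; adding up costs the number of types, and removing the smoothing costs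
  \<open>exp (\<xi> / 4 * n)\<close>. The alternative \<open>h1 = (\<lambda>_. 1)\<close> covers
  tests on the second observation alone.\<close>

lemma typical_mass_le:
  fixes Q :: "'u::finite \<times> 'v::finite \<Rightarrow> real" and PU :: "'u \<Rightarrow> real" and PV :: "'v \<Rightarrow> real" and \<xi> :: real
  assumes Q: "\<And>z. Q z > 0" "sum Q UNIV = 1"
    and PU: "\<And>a. PU a \<ge> 0" "sum PU UNIV = 1"
    and PV: "\<And>b. PV b \<ge> 0" "sum PV UNIV = 1"
    and \<xi>: "\<xi> > 0"
  shows "\<exists>\<delta>>0. \<exists>\<eta>>0. \<forall>\<^sub>F n in sequentially. \<forall>(h1 :: (nat \<Rightarrow> 'u) \<Rightarrow> real) (h2 :: (nat \<Rightarrow> 'v) \<Rightarrow> real) T.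
    (\<forall>x. 0 \<le> h1 x \<and> h1 x \<le> 1) \<and> (\<forall>x. 0 \<le> h2 x \<and> h2 x \<le> 1) \<and>
    mean n d1 PU h1 \<ge> exp (- \<eta> * real n) \<and> mean n d2 PV h2 \<ge> exp (- \<eta> * n) \<and>
    (h1 = (\<lambda>_. 1) \<or> (\<forall>w\<in>T. typical PU \<delta> n (\<lambda>i. fst (w i)))) \<and>
    (\<forall>w\<in>T. typical PV \<delta> n (\<lambda>i. snd (w i))) \<longrightarrow>
    mean n (d1, d2) Q (indicator T) \<le>
      exp (\<xi> * n) * mean n (d1, d2) Q (\<lambda>w. h1 (\<lambda>i. fst (w i)) * h2 (\<lambda>i. snd (w i)))"
proof -
  define m where "m = Min (range Q)"
  have m: "m > 0" "\<And>z. m \<le> Q z" using Q(1) by (auto simp: m_def)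
  \<comment> \<open>The order of choice matters: \<open>r\<close> keeps the exponent lost by
    smoothing under \<open>Q\<close> below \<open>\<xi> / 4\<close> per letter, then
    \<open>q\<close> depends on \<open>r\<close>, and \<open>\<delta>\<close> on
    \<open>q\<close>.\<close>
  define r where "r = min (1 / 2) (m * \<xi> / 12)"
  have r: "0 < r" "r < 1" "3 * r / m \<le> \<xi> / 4"
    using m \<xi> by (auto simp: r_def min_def field_simps)
  obtain q where q: "0 < q" "q \<le> 1" "ln ((1 + r powr - q)\<^sup>2 / (4 * r powr - q)) \<le> q * (\<xi> / 16)"
    using tilt_exists[of "\<xi> / 16" r] \<xi> r by auto
  \<comment> \<open>This \<open>\<delta>\<close> also serves as \<open>\<eta>\<close>; with
    \<open>\<zeta> = q * (\<xi> / 16)\<close> it makes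
    \<open>(\<delta> + \<zeta> + \<eta>) / q = \<xi> / 8\<close>.\<close>
  define \<delta> where "\<delta> = q * \<xi> / 32"
  have \<delta>: "\<delta> > 0" using q \<xi> by (simp add: \<delta>_def)
  let ?K = "exp (\<xi> / 4)"
  have step: "(\<Sum>(a, b)\<in>UNIV. Q (a, b) * ((of_bool (a = a') + r) * (of_bool (b = b') + r))) \<le> ?K * Q (a', b')"
    for a' b'
  proof -
    have "(\<Sum>(a, b)\<in>UNIV. Q (a, b) * ((of_bool (a = a') + r) * (of_bool (b = b') + r)))
        \<le> (\<Sum>z\<in>UNIV. Q z * (of_bool (z = (a', b')) + 3 * r))"
    proof (rule sum_mono, clarify)
      fix a b
      have "r * r \<le> r" using r by (simp add: mult_left_le)
      then have "(of_bool (a = a') + r) * (of_bool (b = b') + r) \<le> of_bool ((a, b) = (a', b')) + 3 * r"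
        using r by (auto simp: algebra_simps)
      then show "Q (a, b) * ((of_bool (a = a') + r) * (of_bool (b = b') + r))
          \<le> Q (a, b) * (of_bool ((a, b) = (a', b')) + 3 * r)"
        using Q(1)[of "(a, b)"] by (intro mult_left_mono) auto
    qed
    also have "\<dots> = Q (a', b') + 3 * r"
      by (simp add: distrib_left sum.distrib Q(2) flip: sum_distrib_right)
    \<comment> \<open>Positivity of \<open>Q\<close> enters here: \<open>m \<le> Q (a', b')\<close>
      turns the additive noise \<open>3 * r\<close> into a relative error.\<close>
    also have "\<dots> \<le> Q (a', b') + 3 * r / m * Q (a', b')"
      using m(1) m(2)[of "(a', b')"] r by (simp add: field_simps)
    also have "\<dots> = (1 + 3 * r / m) * Q (a', b')" by (simp add: distrib_right)
    also have "\<dots> \<le> exp (3 * r / m) * Q (a', b')"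
      using Q(1)[of "(a', b')"] by (intro mult_right_mono exp_ge_add_one_self) auto
    also have "\<dots> \<le> ?K * Q (a', b')"
      using Q(1)[of "(a', b')"] r by (intro mult_right_mono) auto
    finally show ?thesis .
  qed
  have poly: "\<forall>\<^sub>F n in sequentially. real (n + 1) ^ CARD('u \<times> 'v) \<le> exp (\<xi> / 4 * n)"
    using \<xi> by real_asymp
  have "\<forall>\<^sub>F n in sequentially. \<forall>(h1 :: (nat \<Rightarrow> 'u) \<Rightarrow> real) (h2 :: (nat \<Rightarrow> 'v) \<Rightarrow> real) T.
    (\<forall>x. 0 \<le> h1 x \<and> h1 x \<le> 1) \<and> (\<forall>x. 0 \<le> h2 x \<and> h2 x \<le> 1) \<and>
    mean n d1 PU h1 \<ge> exp (- \<delta> * n) \<and> mean n d2 PV h2 \<ge> exp (- \<delta> * n) \<and>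
    (h1 = (\<lambda>_. 1) \<or> (\<forall>w\<in>T. typical PU \<delta> n (\<lambda>i. fst (w i)))) \<and>
    (\<forall>w\<in>T. typical PV \<delta> n (\<lambda>i. snd (w i))) \<longrightarrow>
    mean n (d1, d2) Q (indicator T) \<le>
      exp (\<xi> * n) * mean n (d1, d2) Q (\<lambda>w. h1 (\<lambda>i. fst (w i)) * h2 (\<lambda>i. snd (w i)))"
    using poly eventually_gt_at_top[of 0]
  proof eventually_elim
    case (elim n)
    show ?case
    proof (intro allI impI, elim conjE)
      fix h1 h2 T
      assume h1: "\<forall>x. 0 \<le> h1 x \<and> h1 x \<le> 1" and h2: "\<forall>x. 0 \<le> h2 x \<and> h2 x \<le> 1"
        and m1: "mean n d1 PU h1 \<ge> exp (- \<delta> * n)" and m2: "mean n d2 PV h2 \<ge> exp (- \<delta> * n)"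
        and t1: "h1 = (\<lambda>_. 1) \<or> (\<forall>w\<in>T. typical PU \<delta> n (\<lambda>i. fst (w i)))"
        and t2: "\<forall>w\<in>T. typical PV \<delta> n (\<lambda>i. snd (w i))"
      let ?F = "smooth n d1 r h1" and ?G = "smooth n d2 r h2"
      let ?\<kappa> = "n * \<xi> / 8"
      let ?H = "mean n (d1, d2) Q (\<lambda>w. h1 (\<lambda>i. fst (w i)) * h2 (\<lambda>i. snd (w i)))"
      let ?E = "mean n (d1, d2) Q (\<lambda>w. ?F (\<lambda>i. fst (w i)) * ?G (\<lambda>i. snd (w i)))"
      have F: "?F x > 0" and G: "?G y > 0" for x y
        using m1 m2 r h1 h2
        by (auto intro!: smooth_pos[of _ _ _ _ PU] smooth_pos[of _ _ _ _ PV] intro: less_le_trans[rotated])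
      have \<kappa>: "real n * (\<delta> + q * (\<xi> / 16) + \<delta>) / q = ?\<kappa>"
        using q by (simp add: \<delta>_def field_simps)
      have f: "- ?\<kappa> \<le> mean n d1 (freq n (\<lambda>i. fst (w i))) (\<lambda>x. ln (?F x))" if "w \<in> T" for w
      proof (cases "h1 = (\<lambda>_. 1)")
        case True
        \<comment> \<open>Smoothing the constant 1 gives at least 1 on \<open>seqs n d1\<close>, so
          the logarithm is nonnegative without any typicality of the first coordinate.\<close>
        have "- ?\<kappa> \<le> 0" using \<xi> by simp
        also have "0 \<le> mean n d1 (freq n (\<lambda>i. fst (w i))) (\<lambda>x. ln (?F x))"
          unfolding True using r smooth_one_ge[of r _ n d1]
          by (intro mean_nonneg freq_nonneg ln_ge_zero) auto
        finally show ?thesis .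
      next
        case False
        then show ?thesis
          using mean_ln_smooth_ge[OF PU r(1) q(1,2), where h = h1 and d = d1 and \<zeta> = "q * (\<xi> / 16)"
              and \<delta> = \<delta> and \<eta> = \<delta> and n = n and y = "\<lambda>i. fst (w i)"]
            q h1 \<delta> elim t1 m1 that unfolding \<kappa> by auto
      qed
      have g: "- ?\<kappa> \<le> mean n d2 (freq n (\<lambda>i. snd (w i))) (\<lambda>x. ln (?G x))" if "w \<in> T" for w
        using mean_ln_smooth_ge[OF PV r(1) q(1,2), where h = h2 and d = d2 and \<zeta> = "q * (\<xi> / 16)"
              and \<delta> = \<delta> and \<eta> = \<delta> and n = n and y = "\<lambda>i. snd (w i)"]
          q h2 \<delta> elim t2 m2 that unfolding \<kappa> by auto
      have E0: "?E \<ge> 0"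
        using F G Q(1) by (intro mean_nonneg mult_nonneg_nonneg) (auto intro: less_imp_le)
      have "mean n (d1, d2) Q (indicator T)
          \<le> (\<Sum>w\<in>seqs n (d1, d2). (\<Prod>i<n. freq n w (w i)) * (exp (?\<kappa> + ?\<kappa>) * ?E))"
        unfolding mean_def[of _ _ _ "indicator T"]
      proof (rule sum_mono)
        fix w assume "w \<in> seqs n (d1, d2)"
        show "(\<Prod>i<n. Q (w i)) * indicator T w \<le> (\<Prod>i<n. freq n w (w i)) * (exp (?\<kappa> + ?\<kappa>) * ?E)"
        proof (cases "w \<in> T")
          case True
          then show ?thesis
            using type_lower_bound[OF Q(1), of n d1 ?F d2 ?G ?\<kappa> w ?\<kappa>] elim F G f g by simp
        next
          case False
          then show ?thesis using E0 by (auto intro!: mult_nonneg_nonneg prod_nonneg freq_nonneg)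
        qed
      qed
      also have "\<dots> \<le> real (n + 1) ^ CARD('u \<times> 'v) * (exp (?\<kappa> + ?\<kappa>) * ?E)"
        unfolding sum_distrib_right[symmetric]
        using E0 by (intro mult_right_mono sum_freq_prod_le) auto
      also have "\<dots> \<le> exp (\<xi> / 4 * n) * (exp (?\<kappa> + ?\<kappa>) * (?K ^ n * ?H))"
      proof (rule mult_mono[OF elim(1)])
        have "?E \<le> ?K ^ n * ?H"
          by (rule smooth_pullback) (use Q(1) h1 h2 r step in \<open>auto intro: less_imp_le\<close>)
        then show "exp (?\<kappa> + ?\<kappa>) * ?E \<le> exp (?\<kappa> + ?\<kappa>) * (?K ^ n * ?H)"
          by (rule mult_left_mono) simp
      qed (use E0 in auto)
      also have "\<dots> = exp (3 * \<xi> / 4 * n) * ?H"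
      proof -
        \<comment> \<open>The exponent spent is \<open>\<xi> / 4\<close> on the number of types,
          \<open>\<xi> / 8\<close> on each of the two logarithmic bounds and
          \<open>\<xi> / 4\<close> on smoothing.\<close>
        have "3 * \<xi> / 4 * n = \<xi> / 4 * n + ((?\<kappa> + ?\<kappa>) + \<xi> / 4 * n)"
          by (simp add: field_simps)
        then have "exp (3 * \<xi> / 4 * n) = exp (\<xi> / 4 * n) * (exp (?\<kappa> + ?\<kappa>) * ?K ^ n)"
          by (simp only: exp_add exp_of_nat2_mult)
        then show ?thesis by (simp only: mult.assoc)
      qed
      also have "\<dots> \<le> exp (\<xi> * n) * ?H"
      proof (rule mult_right_mono)
        show "exp (3 * \<xi> / 4 * n) \<le> exp (\<xi> * n)"
          unfolding exp_le_cancel_iff using \<xi> by (intro mult_right_mono) auto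
        show "0 \<le> ?H"
          using h1 h2 by (intro mean_nonneg mult_nonneg_nonneg less_imp_le[OF Q(1)]) auto
      qed
      finally show "mean n (d1, d2) Q (indicator T) \<le> exp (\<xi> * n) * ?H" .
    qed
  qed
  then show ?thesis
    by (intro exI[of _ \<delta>] conjI \<delta>)
qed

section \<open>Achievability\<close>

lemma mean_exp_freq:
  assumes p: "\<And>a. p a \<ge> 0" "sum p UNIV = 1" and \<delta>: "\<delta> > 0" and n: "n > 0"
  shows "mean n d p (\<lambda>x. exp (ln (1 + \<delta>) * n * freq n x a)) = (1 + \<delta> * p a) ^ n"
proof -
  have "mean n d p (\<lambda>x. exp (ln (1 + \<delta>) * n * freq n x a))
      = mean n d p (\<lambda>x. \<Prod>i<n. exp (ln (1 + \<delta>) * of_bool (x i = a)))"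
    using n by (intro mean_cong) (simp add: freq_def mult.commute flip: exp_sum sum_distrib_left)
  also have "\<dots> = (\<Prod>i<n. \<Sum>b\<in>UNIV. p b * exp (ln (1 + \<delta>) * of_bool (b = a)))"
    by (rule mean_prod)
  also have "(\<Sum>b\<in>UNIV. p b * exp (ln (1 + \<delta>) * of_bool (b = a)))
      = (\<Sum>b\<in>UNIV. p b + \<delta> * (p b * of_bool (b = a)))"
    using \<delta> by (intro sum.cong refl) (auto simp: algebra_simps)
  also have "\<dots> = 1 + \<delta> * p a"
    by (simp add: sum.distrib p flip: sum_distrib_left)
  finally show ?thesis by simp
qed

text \<open>Chernoff bound with tilt \<open>ln (1 + \<delta>)\<close>, which optimizes the rate
  obtained through \<open>1 + x \<le> exp x\<close>. A letter of weight 0 never occurs under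
  \<open>p\<close>; the factor \<open>of_bool (p a > 0)\<close> records this, since the exponential
  alone would not decay there.\<close>

lemma mean_freq_exceeds_le:
  assumes p: "\<And>a. p a \<ge> 0" "sum p UNIV = 1" and \<delta>: "\<delta> > 0" and n: "n > 0"
  shows "mean n d p (\<lambda>x. of_bool (freq n x a > (1 + \<delta>) * p a))
    \<le> of_bool (p a > 0) * exp (- (p a * ((1 + \<delta>) * ln (1 + \<delta>) - \<delta>))) ^ n"
proof (cases "p a > 0")
  case True
  let ?s = "ln (1 + \<delta>)"
  let ?e = "exp (- (?s * n * ((1 + \<delta>) * p a)))"
  have "mean n d p (\<lambda>x. of_bool (freq n x a > (1 + \<delta>) * p a))
      \<le> mean n d p (\<lambda>x. ?e * exp (?s * n * freq n x a))"
  proof (intro mean_mono p)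
    fix x
    show "of_bool (freq n x a > (1 + \<delta>) * p a) \<le> ?e * exp (?s * n * freq n x a)"
    proof (cases "freq n x a > (1 + \<delta>) * p a")
      case True
      then have "?s * n * ((1 + \<delta>) * p a) \<le> ?s * n * freq n x a"
        using \<delta> by (intro mult_left_mono) auto
      then show ?thesis by (simp add: flip: exp_add)
    qed simp
  qed
  also have "\<dots> = ?e * (1 + \<delta> * p a) ^ n"
    by (simp only: mean_cmult mean_exp_freq[OF p \<delta> n])
  also have "\<dots> \<le> ?e * exp (\<delta> * p a) ^ n"
    using p \<delta> by (intro mult_left_mono power_mono exp_ge_add_one_self) auto
  also have "\<dots> = exp (- (?s * n * ((1 + \<delta>) * p a)) + (\<delta> * p a) * n)"
    by (simp only: exp_add exp_of_nat2_mult)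
  also have "- (?s * n * ((1 + \<delta>) * p a)) + (\<delta> * p a) * n = - (p a * ((1 + \<delta>) * ?s - \<delta>)) * n"
    by (simp add: algebra_simps)
  finally show ?thesis using True by (simp only: exp_of_nat2_mult of_bool_eq mult_1)
next
  case False
  then have pa: "p a = 0" using p(1)[of a] by simp
  have "(\<Prod>i<n. p (x i)) * of_bool (freq n x a > (1 + \<delta>) * p a) = 0" for x
  proof (cases "\<exists>i<n. x i = a")
    case True
    then show ?thesis using pa by auto
  next
    case False
    then show ?thesis using pa by (simp add: freq_def)
  qed
  then have "mean n d p (\<lambda>x. of_bool (freq n x a > (1 + \<delta>) * p a)) = 0"
    unfolding mean_def by (intro sum.neutral ballI)
  then show ?thesis using pa by simp
qed

lemma atypical_mass_tendsto:
  fixes \<delta> :: real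
  assumes p: "\<And>a. p a \<ge> 0" "sum p UNIV = 1" and \<delta>: "\<delta> > 0"
  shows "(\<lambda>n. mean n d p (\<lambda>x. of_bool (\<not> typical p \<delta> n x))) \<longlonglongrightarrow> 0"
proof (rule tendsto_sandwich[OF _ _ tendsto_const])
  let ?b = "\<lambda>a n. of_bool (p a > 0) * exp (- (p a * ((1 + \<delta>) * ln (1 + \<delta>) - \<delta>))) ^ n"
  show "\<forall>\<^sub>F n in sequentially. 0 \<le> mean n d p (\<lambda>x. of_bool (\<not> typical p \<delta> n x))"
    by (intro always_eventually allI mean_nonneg p) simp
  show "\<forall>\<^sub>F n in sequentially. mean n d p (\<lambda>x. of_bool (\<not> typical p \<delta> n x)) \<le> (\<Sum>a\<in>UNIV. ?b a n)"
    using eventually_gt_at_top[of 0]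
  proof eventually_elim
    case (elim n)
    have "mean n d p (\<lambda>x. of_bool (\<not> typical p \<delta> n x))
        \<le> mean n d p (\<lambda>x. \<Sum>a\<in>UNIV. of_bool (freq n x a > (1 + \<delta>) * p a))"
    proof (intro mean_mono p)
      fix x
      show "of_bool (\<not> typical p \<delta> n x) \<le> (\<Sum>a\<in>UNIV. of_bool (freq n x a > (1 + \<delta>) * p a) :: real)"
      proof (cases "typical p \<delta> n x")
        case False
        then obtain a where a: "freq n x a > (1 + \<delta>) * p a"
          by (auto simp: typical_def not_le)
        have "of_bool (freq n x a > (1 + \<delta>) * p a) \<le> (\<Sum>a\<in>UNIV. of_bool (freq n x a > (1 + \<delta>) * p a) :: real)"
          by (rule member_le_sum) auto
        then show ?thesis using a by simp
      qed (simp add: sum_nonneg)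
    qed
    also have "\<dots> \<le> (\<Sum>a\<in>UNIV. ?b a n)"
      unfolding mean_sum by (intro sum_mono mean_freq_exceeds_le p \<delta> elim)
    finally show ?case .
  qed
  \<comment> \<open>Strictness of \<open>ln x \<le> x - 1\<close> at
    \<open>x = 1 / (1 + \<delta>)\<close> makes the Chernoff rate positive.\<close>
  have "- ln (1 + \<delta>) < 1 / (1 + \<delta>) - 1"
    using ln_le_minus_one[of "1 / (1 + \<delta>)"] ln_eq_minus_one[of "1 / (1 + \<delta>)"] \<delta>
    by (force simp: ln_div)
  then have "(1 + \<delta>) * ln (1 + \<delta>) - \<delta> > 0"
    using \<delta> by (simp add: field_simps)
  then have "?b a \<longlonglongrightarrow> 0" for a
    by (cases "p a > 0") (auto intro!: LIMSEQ_power_zero)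
  then show "(\<lambda>n. \<Sum>a\<in>UNIV. ?b a n) \<longlonglongrightarrow> 0"
    using tendsto_sum[of UNIV "\<lambda>a n. ?b a n" "\<lambda>_. 0" sequentially] by simp
qed

section \<open>Channel outputs and the error criteria\<close>

lemma prob_Pi_pmf_eq:
  fixes d :: "'a::finite"
  shows "measure_pmf.prob (Pi_pmf {..<m} d p) S = (\<Sum>x\<in>seqs m d. (\<Prod>i<m. pmf (p i) (x i)) * of_bool (x \<in> S))"
proof -
  have "measure_pmf.prob (Pi_pmf {..<m} d p) S = measure_pmf.expectation (Pi_pmf {..<m} d p) (indicator S)"
    by simp
  also have "\<dots> = (\<Sum>x\<in>seqs m d. indicator S x * pmf (Pi_pmf {..<m} d p) x)"
    using set_Pi_pmf_subset[of "{..<m}" d p]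
    by (intro integral_measure_pmf_real finite_seqs) (auto simp: seqs_def)
  also have "\<dots> = (\<Sum>x\<in>seqs m d. (\<Prod>i<m. pmf (p i) (x i)) * of_bool (x \<in> S))"
    by (intro sum.cong refl) (auto simp: seqs_def pmf_Pi indicator_def)
  finally show ?thesis .
qed

lemma prob_symbol_seen:
  fixes d :: "'a::finite" and m :: nat
  assumes "j \<le> m"
  shows "measure_pmf.prob (Pi_pmf {..<m} d p) {y. \<exists>i<j. y i = b} = 1 - (\<Prod>i<j. 1 - pmf (p i) b)"
proof -
  let ?M = "Pi_pmf {..<m} d p"
  let ?h = "\<lambda>i a. pmf (p i) a * (if i < j then of_bool (a \<noteq> b) else 1)"
  have "(\<Prod>i<m. if i < j then of_bool (y i \<noteq> b) else 1) = (\<Prod>i<j. of_bool (y i \<noteq> b) :: real)" for y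
    using assms by (intro prod.mono_neutral_cong_right) auto
  moreover have "(\<Prod>i<j. of_bool (y i \<noteq> b)) = (of_bool (\<forall>i<j. y i \<noteq> b) :: real)" for y
    by (cases "\<forall>i<j. y i \<noteq> b") auto
  ultimately have "measure_pmf.prob ?M {y. \<forall>i<j. y i \<noteq> b} = (\<Sum>x\<in>seqs m d. \<Prod>i<m. ?h i (x i))"
    by (simp add: prob_Pi_pmf_eq prod.distrib)
  also have "\<dots> = (\<Prod>i<m. \<Sum>a\<in>UNIV. ?h i a)"
    by (rule sum_seqs_prod)
  also have "\<dots> = (\<Prod>i<m. if i < j then 1 - pmf (p i) b else 1)"
  proof (intro prod.cong refl)
    fix i
    have "(\<Sum>a\<in>UNIV. pmf (p i) a * of_bool (a \<noteq> b)) = (\<Sum>a\<in>UNIV. pmf (p i) a - pmf (p i) a * of_bool (a = b))"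
      by (intro sum.cong refl) auto
    also have "\<dots> = 1 - pmf (p i) b"
      by (simp add: sum_subtractf sum_pmf_eq_1)
    finally show "(\<Sum>a\<in>UNIV. ?h i a) = (if i < j then 1 - pmf (p i) b else 1)"
      by (simp add: sum_pmf_eq_1)
  qed
  also have "\<dots> = (\<Prod>i<j. 1 - pmf (p i) b)"
    using assms by (intro prod.mono_neutral_cong_right) auto
  finally have "measure_pmf.prob ?M {y. \<forall>i<j. y i \<noteq> b} = (\<Prod>i<j. 1 - pmf (p i) b)" .
  moreover have "{y. \<exists>i<j. y i = b} = UNIV - {y. \<forall>i<j. y i \<noteq> b}" by auto
  ultimately show ?thesis
    using measure_pmf.prob_compl[of "{y. \<forall>i<j. y i \<noteq> b}" ?M] by simp
qed

text \<open>\<open>D y\<close> means a decision for hypothesis 1, so acceptance of the null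
  hypothesis is its negation.\<close>

definition accept_prob :: "('x \<Rightarrow> 'y pmf) \<Rightarrow> nat \<Rightarrow> (nat \<Rightarrow> 'x) \<Rightarrow> ((nat \<Rightarrow> 'y) \<Rightarrow> bool) \<Rightarrow> real" where
  "accept_prob \<Gamma> m x D = measure_pmf.prob (Pi_pmf {..<m} undefined (\<lambda>i. \<Gamma> (x i))) {y. \<not> D y}"

lemma accept_prob_bounds: "0 \<le> accept_prob \<Gamma> m x D" "accept_prob \<Gamma> m x D \<le> 1"
  by (simp_all add: accept_prob_def)

abbreviation source_mean :: "nat \<Rightarrow> ('u::finite \<times> 'v::finite) pmf \<Rightarrow> ((nat \<Rightarrow> 'u \<times> 'v) \<Rightarrow> real) \<Rightarrow> real" where
  "source_mean n R \<equiv> mean n (undefined, undefined) (pmf R)"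

text \<open>Taken at \<open>R = P\<close>, the quantity \<open>type2_error R\<close> is the probability of acceptance under the null
  hypothesis.\<close>

lemma type2_error_eq:
  fixes R :: "('u::finite \<times> 'v::finite) pmf" and \<Gamma> :: "'x \<Rightarrow> 'y pmf"
  shows "type2_error R \<Gamma> n m f g
    = source_mean n R (\<lambda>w. accept_prob \<Gamma> m (f (\<lambda>i. fst (w i))) (g (\<lambda>i. snd (w i))))"
proof -
  let ?S = "Pi_pmf {..<n} (undefined, undefined) (\<lambda>_. R)"
  let ?N = "\<lambda>w. map_pmf (\<lambda>y. (\<lambda>i. fst (w i), \<lambda>i. snd (w i), f (\<lambda>i. fst (w i)), y))
      (Pi_pmf {..<m} undefined (\<lambda>i. \<Gamma> (f (\<lambda>i. fst (w i)) i)))"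
  have "type2_error R \<Gamma> n m f g = measure_pmf.prob (bind_pmf ?S ?N) {(u, v, x, y). \<not> g v y}"
    by (simp add: type2_error_def system_pmf_def Let_def map_pmf_def)
  also have "\<dots> = measure_pmf.expectation ?S (\<lambda>w. measure_pmf.prob (?N w) {(u, v, x, y). \<not> g v y})"
    unfolding measure_pmf_bind
    by (rule measure_pmf.measure_bind[where N = "count_space UNIV"]) (auto simp: measure_subprob)
  also have "\<dots> = measure_pmf.expectation ?S (\<lambda>w. accept_prob \<Gamma> m (f (\<lambda>i. fst (w i))) (g (\<lambda>i. snd (w i))))"
    by (simp add: accept_prob_def vimage_def)
  also have "\<dots> = (\<Sum>w\<in>seqs n (undefined, undefined).
      accept_prob \<Gamma> m (f (\<lambda>i. fst (w i))) (g (\<lambda>i. snd (w i))) * pmf ?S w)"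
    using set_Pi_pmf_subset[of "{..<n}" "(undefined, undefined)" "\<lambda>_. R"]
    by (intro integral_measure_pmf_real finite_seqs) (auto simp: seqs_def)
  also have "\<dots> = source_mean n R (\<lambda>w. accept_prob \<Gamma> m (f (\<lambda>i. fst (w i))) (g (\<lambda>i. snd (w i))))"
    unfolding mean_def by (intro sum.cong refl) (auto simp: seqs_def pmf_Pi)
  finally show ?thesis .
qed

lemma type1_error_eq: "type1_error R \<Gamma> n m f g = 1 - type2_error R \<Gamma> n m f g"
proof -
  have compl: "{(u, v, x, y). g v y} = UNIV - {(u, v, x, y). \<not> g v y}" by auto
  show ?thesis
    unfolding type1_error_def type2_error_def compl
    using measure_pmf.prob_compl[of "{(u, v, x, y). \<not> g v y}" "system_pmf R \<Gamma> n m f"] by simp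
qed

lemma error_exponent_ge:
  assumes "n > 0" "p \<ge> 0" "p \<le> exp (- \<theta> * real n)"
  shows "ereal \<theta> \<le> error_exponent n p"
proof (cases "p = 0")
  case False
  then have "ln p \<le> - \<theta> * real n"
    using assms ln_mono[of p "exp (- \<theta> * real n)"] by simp
  then show ?thesis using assms False by (simp add: error_exponent_def field_simps)
qed (simp add: error_exponent_def)

lemma error_exponent_gtD:
  assumes "n > 0" "p \<ge> 0" "ereal \<theta> < error_exponent n p"
  shows "p \<le> exp (- \<theta> * real n)"
proof (cases "p = 0")
  case False
  then have "ln p \<le> - \<theta> * real n"
    using assms by (simp add: error_exponent_def field_simps)
  then have "exp (ln p) \<le> exp (- \<theta> * real n)" by (simp only: exp_le_cancel_iff)
  then show ?thesis using assms False by simp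
qed simp

lemma achieves_type2_le:
  assumes "achieves P Q \<Gamma> m \<epsilon> \<theta> f g" "\<theta>' < \<theta>"
  shows "\<forall>\<^sub>F n in sequentially. type2_error Q \<Gamma> n (m n) (f n) (g n) \<le> exp (- \<theta>' * real n)"
proof -
  have "ereal \<theta>' < liminf (\<lambda>n. error_exponent n (type2_error Q \<Gamma> n (m n) (f n) (g n)))"
    using assms by (auto simp: achieves_def intro: less_le_trans[rotated])
  then have "\<forall>\<^sub>F n in sequentially. ereal \<theta>' < error_exponent n (type2_error Q \<Gamma> n (m n) (f n) (g n))"
    by (rule less_LiminfD)
  then show ?thesis
    using eventually_gt_at_top[of 0]
    by eventually_elim (intro error_exponent_gtD, auto simp: type2_error_def)
qed

lemma achieves_acceptance:
  assumes "achieves P Q \<Gamma> m \<epsilon> \<theta> f g" "\<epsilon> < \<epsilon>'"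
  shows "\<forall>\<^sub>F n in sequentially. type2_error P \<Gamma> n (m n) (f n) (g n) \<ge> 1 - \<epsilon>'"
proof -
  have "limsup (\<lambda>n. ereal (type1_error P \<Gamma> n (m n) (f n) (g n))) < ereal \<epsilon>'"
    using assms by (auto simp: achieves_def intro: le_less_trans)
  then have "\<forall>\<^sub>F n in sequentially. ereal (type1_error P \<Gamma> n (m n) (f n) (g n)) < ereal \<epsilon>'"
    by (rule Limsup_lessD)
  then show ?thesis by eventually_elim (simp add: type1_error_eq)
qed

text \<open>Acceptance tending to 1 gives a vanishing first error, which meets every
  \<open>\<epsilon> \<ge> 0\<close>. With a converse for all \<open>\<epsilon> < 1\<close>, this
  makes the exponent independent of \<open>\<epsilon>\<close>.\<close>

lemma achievesI:
  assumes "0 \<le> \<epsilon>"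
    and "(\<lambda>n. type2_error P \<Gamma> n (m n) (f n) (g n)) \<longlonglongrightarrow> 1"
    and "\<forall>\<^sub>F n in sequentially. type2_error Q \<Gamma> n (m n) (f n) (g n) \<le> exp (- \<theta> * real n)"
  shows "achieves P Q \<Gamma> m \<epsilon> \<theta> f g"
  unfolding achieves_def
proof
  have "(\<lambda>n. type1_error P \<Gamma> n (m n) (f n) (g n)) \<longlonglongrightarrow> 0"
    unfolding type1_error_eq using tendsto_diff[OF tendsto_const assms(2), of 1] by simp
  then have "limsup (\<lambda>n. ereal (type1_error P \<Gamma> n (m n) (f n) (g n))) = 0"
    by (intro lim_imp_Limsup) (auto simp: zero_ereal_def)
  then show "limsup (\<lambda>n. ereal (type1_error P \<Gamma> n (m n) (f n) (g n))) \<le> ereal \<epsilon>"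
    using assms(1) by (simp add: zero_ereal_def)
  show "ereal \<theta> \<le> liminf (\<lambda>n. error_exponent n (type2_error Q \<Gamma> n (m n) (f n) (g n)))"
    using assms(3) eventually_gt_at_top[of 0]
    by (intro Liminf_bounded, eventually_elim) (intro error_exponent_ge, auto simp: type2_error_def)
qed

section \<open>The typicality test and its implementation over the channel\<close>

definition same_supports :: "('x::zero \<Rightarrow> 'y pmf) \<Rightarrow> bool" where
  "same_supports \<Gamma> \<longleftrightarrow> (\<forall>x. set_pmf (\<Gamma> x) = set_pmf (\<Gamma> 0))"

abbreviation fst_weight :: "('u \<times> 'v) pmf \<Rightarrow> 'u \<Rightarrow> real" where
  "fst_weight P a \<equiv> (\<Sum>z | fst z = a. pmf P z)"

abbreviation snd_weight :: "('u \<times> 'v) pmf \<Rightarrow> 'v \<Rightarrow> real" where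
  "snd_weight P b \<equiv> (\<Sum>z | snd z = b. pmf P z)"

text \<open>When all input letters have the same output support, the sensor is useless at sublinear rate,
  and only the observation of the decision center is tested for typicality.\<close>

definition region ::
  "('u \<times> 'v) pmf \<Rightarrow> ('x::zero \<Rightarrow> 'y pmf) \<Rightarrow> real \<Rightarrow> nat \<Rightarrow> (nat \<Rightarrow> 'u \<times> 'v) set" where
  "region P \<Gamma> \<delta> n = {w. (same_supports \<Gamma> \<or> typical (fst_weight P) \<delta> n (\<lambda>i. fst (w i))) \<and>
     typical (snd_weight P) \<delta> n (\<lambda>i. snd (w i))}"

lemma sum_image_weight:
  fixes P :: "'w::finite pmf" and \<pi> :: "'w \<Rightarrow> 'a::finite"
  shows "(\<Sum>a\<in>UNIV. \<Sum>z | \<pi> z = a. pmf P z) = 1"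
  using sum.group[of UNIV UNIV \<pi> "pmf P"] by (simp add: sum_pmf_eq_1)

lemma region_mass_tendsto:
  fixes P :: "('u::finite \<times> 'v::finite) pmf"
  assumes "\<delta> > 0"
  shows "(\<lambda>n. source_mean n P (indicator (region P \<Gamma> \<delta> n))) \<longlonglongrightarrow> 1"
proof (rule tendsto_sandwich[OF _ _ _ tendsto_const])
  let ?A = "\<lambda>n. mean n undefined (fst_weight P) (\<lambda>x. of_bool (\<not> typical (fst_weight P) \<delta> n x))"
  let ?B = "\<lambda>n. mean n undefined (snd_weight P) (\<lambda>x. of_bool (\<not> typical (snd_weight P) \<delta> n x))"
  have P1: "sum (pmf P) UNIV = 1" by (simp add: sum_pmf_eq_1)
  have "source_mean n P (\<lambda>w. 1 - of_bool (\<not> typical (fst_weight P) \<delta> n (\<lambda>i. fst (w i)))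
      - of_bool (\<not> typical (snd_weight P) \<delta> n (\<lambda>i. snd (w i))))
    \<le> source_mean n P (indicator (region P \<Gamma> \<delta> n))" for n
    by (intro mean_mono) (auto simp: region_def indicator_def)
  moreover have "source_mean n P (\<lambda>w. 1 - of_bool (\<not> typical (fst_weight P) \<delta> n (\<lambda>i. fst (w i)))
      - of_bool (\<not> typical (snd_weight P) \<delta> n (\<lambda>i. snd (w i)))) = 1 - ?A n - ?B n" for n
  proof -
    have "source_mean n P (\<lambda>w. 1 - of_bool (\<not> typical (fst_weight P) \<delta> n (\<lambda>i. fst (w i)))
      - of_bool (\<not> typical (snd_weight P) \<delta> n (\<lambda>i. snd (w i))))
      = source_mean n P (\<lambda>w. (1 + - 1 * of_bool (\<not> typical (fst_weight P) \<delta> n (\<lambda>i. fst (w i))))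
        + - 1 * of_bool (\<not> typical (snd_weight P) \<delta> n (\<lambda>i. snd (w i))))"
      by (intro mean_cong) simp
    then show ?thesis
      unfolding mean_add mean_cmult mean_const[OF P1]
      using mean_image[of n "(undefined, undefined)" "pmf P" "\<lambda>x. of_bool (\<not> typical (fst_weight P) \<delta> n x)" fst]
        mean_image[of n "(undefined, undefined)" "pmf P" "\<lambda>x. of_bool (\<not> typical (snd_weight P) \<delta> n x)" snd]
      by simp
  qed
  ultimately show "\<forall>\<^sub>F n in sequentially. 1 - ?A n - ?B n \<le> source_mean n P (indicator (region P \<Gamma> \<delta> n))"
    by simp
  have "source_mean n P (indicator (region P \<Gamma> \<delta> n)) \<le> source_mean n P (\<lambda>_. 1)" for n
    by (intro mean_mono) (auto simp: indicator_def)
  then show "\<forall>\<^sub>F n in sequentially. source_mean n P (indicator (region P \<Gamma> \<delta> n)) \<le> 1"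
    by (simp add: mean_const[OF P1])
  have "?A \<longlonglongrightarrow> 0" "?B \<longlonglongrightarrow> 0"
    using assms by (auto intro!: atypical_mass_tendsto sum_image_weight sum_nonneg)
  then have "(\<lambda>n. 1 - ?A n - ?B n) \<longlonglongrightarrow> 1 - 0 - 0"
    by (intro tendsto_diff tendsto_const)
  then show "(\<lambda>n. 1 - ?A n - ?B n) \<longlonglongrightarrow> 1" by simp
qed

text \<open>\<open>m n\<close> counts the channel uses and \<open>j n\<close> bounds those that
  carry information; the letter 0 fills the rest. Keeping the two apart serves both the short block
  and the long block with a small budget.\<close>

lemma exponent_achievable:
  fixes P Q :: "('u::finite \<times> 'v::finite) pmf" and \<Gamma> :: "'x::zero \<Rightarrow> 'y::finite pmf"
  assumes \<delta>: "\<delta> > 0" and \<epsilon>: "\<epsilon> \<ge> 0"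
    and Q: "\<forall>\<^sub>F n in sequentially. source_mean n Q (indicator (region P \<Gamma> \<delta> n)) \<le> exp (- \<theta> * real n)"
    and j: "filterlim j at_top sequentially" "\<And>n. j n \<le> m n"
  shows "\<exists>f g. achieves P Q \<Gamma> m \<epsilon> \<theta> f g \<and> (\<forall>n u i. j n \<le> i \<longrightarrow> f n u i = 0)"
proof -
  \<comment> \<open>In both cases acceptance has probability \<open>\<kappa> n\<close> times the
    indicator of the region, with \<open>\<kappa> n\<close> the chance that the sensor's approval is
    recognized.\<close>
  have reduce: "achieves P Q \<Gamma> m \<epsilon> \<theta> f g"
    if f: "\<And>R n. type2_error R \<Gamma> n (m n) (f n) (g n) = \<kappa> n * source_mean n R (indicator (region P \<Gamma> \<delta> n))"
      and \<kappa>: "\<kappa> \<longlonglongrightarrow> 1" "\<And>n. \<kappa> n \<le> 1" for f :: "nat \<Rightarrow> ('u, 'x) encoder" and g :: "nat \<Rightarrow> ('v, 'y) decider" and \<kappa>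
  proof (rule achievesI[OF \<epsilon>])
    show "(\<lambda>n. type2_error P \<Gamma> n (m n) (f n) (g n)) \<longlonglongrightarrow> 1"
      unfolding f using tendsto_mult[OF \<kappa>(1) region_mass_tendsto[OF \<delta>]] by simp
    show "\<forall>\<^sub>F n in sequentially. type2_error Q \<Gamma> n (m n) (f n) (g n) \<le> exp (- \<theta> * real n)"
      using Q
    proof eventually_elim
      case (elim n)
      have "\<kappa> n * source_mean n Q (indicator (region P \<Gamma> \<delta> n)) \<le> 1 * source_mean n Q (indicator (region P \<Gamma> \<delta> n))"
        by (intro mult_right_mono \<kappa> mean_nonneg) auto
      with elim show ?case by (simp add: f)
    qed
  qed
  show ?thesis
  proof (cases "same_supports \<Gamma>")
    case True
    let ?g = "\<lambda>n v y. \<not> typical (snd_weight P) \<delta> n v"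
    have "type2_error R \<Gamma> n (m n) (\<lambda>_ _. 0) (?g n) = 1 * source_mean n R (indicator (region P \<Gamma> \<delta> n))" for R n
      unfolding type2_error_eq mult_1
      by (intro mean_cong) (auto simp: accept_prob_def region_def True indicator_def)
    then have "achieves P Q \<Gamma> m \<epsilon> \<theta> (\<lambda>_ _ _. 0) ?g"
      by (rule reduce) auto
    then show ?thesis by (intro exI[of _ "\<lambda>_ _ _. 0"] exI[of _ ?g]) auto
  next
    case False
    then obtain x where "set_pmf (\<Gamma> x) \<noteq> set_pmf (\<Gamma> 0)" by (auto simp: same_supports_def)
    \<comment> \<open>The supports of \<open>x\<close> and 0 differ in at least one direction;
      \<open>x1\<close> is the letter of the two that can produce \<open>b\<close>, and
      \<open>x0\<close> the other.\<close>
    then obtain x1 x0 b where b: "b \<in> set_pmf (\<Gamma> x1)" "b \<notin> set_pmf (\<Gamma> x0)" by blast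
    define \<rho> where "\<rho> = pmf (\<Gamma> x1) b"
    have \<rho>: "0 < \<rho>" "\<rho> \<le> 1" using b by (auto simp: \<rho>_def pmf_positive pmf_le_1)
    have b0: "pmf (\<Gamma> x0) b = 0" using b by (simp add: set_pmf_iff)
    define f where "f = (\<lambda>n u i. if i < j n then if typical (fst_weight P) \<delta> n u then x1 else x0 else 0)"
    define g where "g = (\<lambda>n v y. \<not> (typical (snd_weight P) \<delta> n v \<and> (\<exists>i<j n. y i = b)))"
    \<comment> \<open>The probability that \<open>b\<close> appears at least once when
      \<open>x1\<close> is sent \<open>j n\<close> times. Under \<open>x0\<close> it never appears
      among the inspected outputs.\<close>
    define \<kappa> where "\<kappa> = (\<lambda>n. 1 - (1 - \<rho>) ^ j n)"
    have acc: "accept_prob \<Gamma> (m n) (f n (\<lambda>i. fst (w i))) (g n (\<lambda>i. snd (w i))) = \<kappa> n * indicator (region P \<Gamma> \<delta> n) w"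
      for n w
      using prob_symbol_seen[OF j(2), of n undefined "\<lambda>i. \<Gamma> (f n (\<lambda>i. fst (w i)) i)" b] False
      by (cases "typical (fst_weight P) \<delta> n (\<lambda>i. fst (w i))";
          cases "typical (snd_weight P) \<delta> n (\<lambda>i. snd (w i))")
        (simp_all add: accept_prob_def g_def region_def f_def \<kappa>_def b0 flip: \<rho>_def)
    have "achieves P Q \<Gamma> m \<epsilon> \<theta> f g"
    proof (rule reduce)
      show "type2_error R \<Gamma> n (m n) (f n) (g n) = \<kappa> n * source_mean n R (indicator (region P \<Gamma> \<delta> n))" for R n
        unfolding type2_error_eq acc mean_cmult ..
      have "(\<lambda>k. (1 - \<rho>) ^ k) \<longlonglongrightarrow> 0" using \<rho> by (intro LIMSEQ_power_zero) auto
      then have "(\<lambda>n. (1 - \<rho>) ^ j n) \<longlonglongrightarrow> 0" using j(1) by (rule filterlim_compose)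
      then show "\<kappa> \<longlonglongrightarrow> 1"
        unfolding \<kappa>_def using tendsto_diff[OF tendsto_const, of "\<lambda>n. (1 - \<rho>) ^ j n" 0 _ 1] by simp
      show "\<kappa> n \<le> 1" for n using \<rho> by (simp add: \<kappa>_def)
    qed
    then show ?thesis by (intro exI[of _ f] exI[of _ g]) (auto simp: f_def)
  qed
qed

section \<open>Converse\<close>

text \<open>Channel uses beyond a few are wasted on the letter \<open>0\<close>: this is the common relaxation of both the
  sublinear number of channel uses and the cost constraint.\<close>

definition sparse_inputs :: "(nat \<Rightarrow> nat) \<Rightarrow> (nat \<Rightarrow> ('u, 'x::zero) encoder) \<Rightarrow> bool" where
  "sparse_inputs m f \<longleftrightarrow> (\<forall>\<eta>>0. \<forall>\<^sub>F n in sequentially. m n \<le> n \<and>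
     (\<forall>u\<in>seqs n undefined. real (card {i. i < m n \<and> f n u i \<noteq> 0}) \<le> \<eta> * real n))"

text \<open>Equal supports make the zeros of the output laws coincide, and finiteness of the
  alphabets gives the remaining likelihood ratios a positive minimum.\<close>

lemma same_supports_ratio:
  fixes \<Gamma> :: "'x::{finite, zero} \<Rightarrow> 'y::finite pmf"
  assumes "same_supports \<Gamma>"
  obtains b where "b \<ge> 0" "\<And>x x' y. exp (- b) * pmf (\<Gamma> x') y \<le> pmf (\<Gamma> x) y"
proof -
  let ?r = "\<lambda>(x, x', y). if pmf (\<Gamma> x') y = 0 then 1 else pmf (\<Gamma> x) y / pmf (\<Gamma> x') y"
  define \<gamma> where "\<gamma> = Min (range ?r)"
  have "set_pmf (\<Gamma> x) = set_pmf (\<Gamma> x')" for x x'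
    using assms by (auto simp: same_supports_def)
  then have pos: "pmf (\<Gamma> x') y \<noteq> 0 \<Longrightarrow> pmf (\<Gamma> x) y > 0" for x x' y
    by (metis pmf_positive set_pmf_iff)
  have "?r z > 0" for z
    using pos by (cases z) (auto intro!: divide_pos_pos simp: less_le)
  then have \<gamma>: "\<gamma> > 0" unfolding \<gamma>_def by (subst Min_gr_iff) auto
  have le: "\<gamma> \<le> ?r z" for z unfolding \<gamma>_def by (intro Min_le) auto
  obtain y where "y \<in> set_pmf (\<Gamma> 0)" using set_pmf_not_empty by fast
  then have "\<gamma> \<le> 1" using le[of "(0, 0, y)"] by (auto split: if_splits)
  show ?thesis
  proof (rule that[of "- ln \<gamma>"])
    show "0 \<le> - ln \<gamma>" using \<gamma> \<open>\<gamma> \<le> 1\<close> by simp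
    show "exp (- (- ln \<gamma>)) * pmf (\<Gamma> x') y \<le> pmf (\<Gamma> x) y" for x x' y
      using le[of "(x, x', y)"] \<gamma> pmf_nonneg[of "\<Gamma> x'" y] by (auto simp: field_simps split: if_splits)
  qed
qed

lemma prod_exp_of_bool:
  fixes t :: real and m :: nat
  shows
  "(\<Prod>i<m. exp (- t * of_bool (S i))) = exp (- t * real (card {i. i < m \<and> S i}))"
proof -
  have "(\<Sum>i<m. of_bool (S i)) = real (card {i. i < m \<and> S i})" by (simp add: Int_def)
  then show ?thesis
    by (simp only: exp_sum[OF finite_lessThan, symmetric] sum_distrib_left[symmetric])
qed

text \<open>Likelihoods factor over positions: equal inputs cost nothing, and each differing input
  costs at most a factor \<open>exp (- b)\<close>.\<close>

lemma accept_prob_change_input: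
  fixes \<Gamma> :: "'x \<Rightarrow> 'y::finite pmf"
  assumes b: "b \<ge> 0" "\<And>x x' y. exp (- b) * pmf (\<Gamma> x') y \<le> pmf (\<Gamma> x) y"
    and N: "real (card {i. i < m \<and> x i \<noteq> x' i}) \<le> N"
  shows "exp (- b * N) * accept_prob \<Gamma> m x' D \<le> accept_prob \<Gamma> m x D"
proof -
  have "exp (- b * N) * (\<Prod>i<m. pmf (\<Gamma> (x' i)) (y i)) \<le> (\<Prod>i<m. pmf (\<Gamma> (x i)) (y i))" for y
  proof -
    let ?c = "card {i. i < m \<and> x i \<noteq> x' i}"
    have "exp (- b * N) \<le> exp (- b * ?c)"
      using b N by (simp add: mult_left_mono)
    also have "\<dots> = (\<Prod>i<m. exp (- b * of_bool (x i \<noteq> x' i)))"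
      by (rule prod_exp_of_bool[symmetric])
    finally have "exp (- b * N) * (\<Prod>i<m. pmf (\<Gamma> (x' i)) (y i))
        \<le> (\<Prod>i<m. exp (- b * of_bool (x i \<noteq> x' i))) * (\<Prod>i<m. pmf (\<Gamma> (x' i)) (y i))"
      by (intro mult_right_mono prod_nonneg) auto
    also have "\<dots> = (\<Prod>i<m. exp (- b * of_bool (x i \<noteq> x' i)) * pmf (\<Gamma> (x' i)) (y i))"
      by (simp add: prod.distrib)
    also have "\<dots> \<le> (\<Prod>i<m. pmf (\<Gamma> (x i)) (y i))"
      using b by (intro prod_mono) auto
    finally show ?thesis .
  qed
  then show ?thesis
    unfolding accept_prob_def prob_Pi_pmf_eq sum_distrib_left mult.assoc[symmetric]
    by (intro sum_mono mult_right_mono) auto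
qed

text \<open>Chernoff bound for counting: weight a sequence by \<open>exp (t * (N - number of nonzero letters)) \<ge> 1\<close>.\<close>

lemma card_sparse_le:
  fixes S :: "(nat \<Rightarrow> 'x::{finite, zero}) set"
  assumes S: "\<And>x. x \<in> S \<Longrightarrow> x \<in> seqs m 0 \<and> real (card {i. i < m \<and> x i \<noteq> 0}) \<le> N"
    and t: "t \<ge> 0"
  shows "real (card S) \<le> exp (t * N) * exp (CARD('x) * exp (- t)) ^ m"
proof -
  have "real (card S) = (\<Sum>x\<in>S. 1)" by simp
  also have "\<dots> \<le> (\<Sum>x\<in>S. exp (t * N) * (\<Prod>i<m. exp (- t * of_bool (x i \<noteq> 0))))"
  proof (rule sum_mono)
    fix x assume "x \<in> S"
    have "(\<Prod>i<m. exp (- t * of_bool (x i \<noteq> 0))) = exp (- t * card {i. i < m \<and> x i \<noteq> 0})"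
      by (rule prod_exp_of_bool)
    moreover have "t * card {i. i < m \<and> x i \<noteq> 0} \<le> t * N"
      using S[OF \<open>x \<in> S\<close>] t by (intro mult_left_mono) auto
    ultimately show "1 \<le> exp (t * N) * (\<Prod>i<m. exp (- t * of_bool (x i \<noteq> 0)))"
      by (simp flip: exp_add)
  qed
  also have "\<dots> \<le> (\<Sum>x\<in>seqs m (0 :: 'x). exp (t * N) * (\<Prod>i<m. exp (- t * of_bool (x i \<noteq> 0))))"
  proof (rule sum_mono2)
    show "S \<subseteq> seqs m (0 :: 'x)" using S by blast
  qed (auto intro!: mult_nonneg_nonneg prod_nonneg simp del: mult_minus_left)
  also have "\<dots> = exp (t * N) * (\<Sum>a::'x\<in>UNIV. exp (- t * of_bool (a \<noteq> 0))) ^ m"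
    using sum_seqs_prod[of "\<lambda>_ a. exp (- t * of_bool (a \<noteq> 0))" m "0 :: 'x"]
    by (simp flip: sum_distrib_left)
  also have "\<dots> \<le> exp (t * N) * exp (CARD('x) * exp (- t)) ^ m"
  proof (intro mult_left_mono power_mono)
    have "(\<Sum>a::'x\<in>UNIV. exp (- t * of_bool (a \<noteq> 0))) \<le> (\<Sum>a::'x\<in>UNIV. of_bool (a = 0) + exp (- t))"
      by (intro sum_mono) auto
    also have "\<dots> = 1 + CARD('x) * exp (- t)" by (simp add: sum.distrib)
    also have "\<dots> \<le> exp (CARD('x) * exp (- t))" by (rule exp_ge_add_one_self)
    finally show "(\<Sum>a::'x\<in>UNIV. exp (- t * of_bool (a \<noteq> 0))) \<le> exp (CARD('x) * exp (- t))" .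
  qed (auto intro: sum_nonneg)
  finally show ?thesis .
qed

lemma source_mean_fst:
  "source_mean n P (\<lambda>w. h (\<lambda>i. fst (w i))) = mean n undefined (fst_weight P) h"
  using mean_image[of n "(undefined, undefined)" "pmf P" h fst] by simp

lemma source_mean_snd:
  "source_mean n P (\<lambda>w. h (\<lambda>i. snd (w i))) = mean n undefined (snd_weight P) h"
  using mean_image[of n "(undefined, undefined)" "pmf P" h snd] by simp

lemma fst_seqs: "w \<in> seqs n (undefined, undefined) \<Longrightarrow> (\<lambda>i. fst (w i)) \<in> seqs n undefined"
  by (auto simp: seqs_def)

text \<open>With equal supports, replacing the few nonzero inputs by \<open>0\<close> changes all probabilities by at
  most a subexponential factor, so that the decision depends on \<open>V\<^sup>n\<close> alone.\<close>

lemma rectangle_same_supports: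
  fixes P Q :: "('u::finite \<times> 'v::finite) pmf" and \<Gamma> :: "'x::{finite, zero} \<Rightarrow> 'y::finite pmf"
  assumes same: "same_supports \<Gamma>" and sparse: "sparse_inputs m f"
    and acc: "\<forall>\<^sub>F n in sequentially. type2_error P \<Gamma> n (m n) (f n) (g n) \<ge> a" and a: "a > 0" and \<eta>: "\<eta> > 0"
  shows "\<forall>\<^sub>F n in sequentially. \<exists>h. (\<forall>y. 0 \<le> h y \<and> h y \<le> 1) \<and>
    exp (- \<eta> * real n) \<le> mean n undefined (snd_weight P) h \<and>
    exp (- \<eta> * real n) * source_mean n Q (\<lambda>w. h (\<lambda>i. snd (w i))) \<le> type2_error Q \<Gamma> n (m n) (f n) (g n)"
proof -
  obtain b where b: "b \<ge> 0" "\<And>x x' y. exp (- b) * pmf (\<Gamma> x') y \<le> pmf (\<Gamma> x) y"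
    using same_supports_ratio[OF same] by blast
  \<comment> \<open>Half of \<open>\<eta>\<close> pays for changing \<open>s * n\<close> inputs, the
    other half for the constant \<open>a\<close>. The \<open>+ 1\<close> avoids division by zero
    when \<open>b = 0\<close>.\<close>
  define s where "s = \<eta> / (2 * (b + 1))"
  have s: "s > 0" "b * s \<le> \<eta> / 2" using b \<eta> by (auto simp: s_def field_simps)
  have ev: "\<forall>\<^sub>F n in sequentially. exp (- \<eta> / 2 * real n) \<le> a"
    using a \<eta> by real_asymp
  have "\<forall>\<^sub>F n in sequentially. m n \<le> n \<and>
     (\<forall>u\<in>seqs n undefined. real (card {i. i < m n \<and> f n u i \<noteq> 0}) \<le> s * real n)"
    using sparse s by (simp add: sparse_inputs_def)
  then show ?thesis
    using acc ev
  proof eventually_elim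
    case (elim n)
    let ?h = "\<lambda>v. accept_prob \<Gamma> (m n) (\<lambda>_. 0) (g n v)"
    let ?A = "\<lambda>w. accept_prob \<Gamma> (m n) (f n (\<lambda>i. fst (w i))) (g n (\<lambda>i. snd (w i)))"
    let ?e = "exp (- \<eta> / 2 * real n)"
    have e: "?e \<le> exp (- b * (s * real n))"
      using mult_right_mono[OF s(2), of "real n"] by simp
    have up: "?e * ?h (\<lambda>i. snd (w i)) \<le> ?A w" and down: "?e * ?A w \<le> ?h (\<lambda>i. snd (w i))"
      if "w \<in> seqs n (undefined, undefined)" for w
    proof -
      have card: "real (card {i. i < m n \<and> f n (\<lambda>i. fst (w i)) i \<noteq> 0}) \<le> s * real n"
        using elim fst_seqs[OF that] by blast
      have "?e * ?h (\<lambda>i. snd (w i)) \<le> exp (- b * (s * real n)) * ?h (\<lambda>i. snd (w i))"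
        by (intro mult_right_mono e accept_prob_bounds)
      also have "\<dots> \<le> ?A w" by (rule accept_prob_change_input[OF b card])
      finally show "?e * ?h (\<lambda>i. snd (w i)) \<le> ?A w" .
      have "?e * ?A w \<le> exp (- b * (s * real n)) * ?A w"
        by (intro mult_right_mono e accept_prob_bounds)
      also have "\<dots> \<le> ?h (\<lambda>i. snd (w i))"
        using card by (intro accept_prob_change_input[OF b]) (simp add: eq_commute[of "0 :: 'x"])
      finally show "?e * ?A w \<le> ?h (\<lambda>i. snd (w i))" .
    qed
    have "exp (- \<eta> * real n) = ?e * ?e" by (simp flip: exp_add)
    also have "\<dots> \<le> ?e * source_mean n P ?A"
      using elim by (intro mult_left_mono) (auto simp: type2_error_eq)
    also have "\<dots> \<le> source_mean n P (\<lambda>w. ?h (\<lambda>i. snd (w i)))"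
      unfolding mean_cmult[symmetric] by (intro mean_mono down) auto
    also have "\<dots> = mean n undefined (snd_weight P) ?h" by (rule source_mean_snd)
    finally have 1: "exp (- \<eta> * real n) \<le> mean n undefined (snd_weight P) ?h" .
    have "exp (- \<eta> * real n) * source_mean n Q (\<lambda>w. ?h (\<lambda>i. snd (w i))) \<le> ?e * source_mean n Q (\<lambda>w. ?h (\<lambda>i. snd (w i)))"
      using \<eta> by (intro mult_right_mono mean_nonneg accept_prob_bounds) (auto simp: mult_right_mono)
    also have "\<dots> \<le> source_mean n Q ?A"
      unfolding mean_cmult[symmetric] by (intro mean_mono up) auto
    also have "\<dots> = type2_error Q \<Gamma> n (m n) (f n) (g n)" by (simp add: type2_error_eq)
    finally have 2: "exp (- \<eta> * real n) * source_mean n Q (\<lambda>w. ?h (\<lambda>i. snd (w i))) \<le> type2_error Q \<Gamma> n (m n) (f n) (g n)" .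
    show ?case
      by (intro exI[of _ ?h] conjI allI accept_prob_bounds 1 2)
  qed
qed

text \<open>There are only subexponentially many channel inputs. By pigeonhole one of them carries a
  subexponential share of the acceptance probability.\<close>

lemma rectangle_few_inputs:
  fixes P Q :: "('u::finite \<times> 'v::finite) pmf" and \<Gamma> :: "'x::{finite, zero} \<Rightarrow> 'y::finite pmf"
  assumes sparse: "sparse_inputs m f"
    and acc: "\<forall>\<^sub>F n in sequentially. type2_error P \<Gamma> n (m n) (f n) (g n) \<ge> a" and a: "a > 0" and \<eta>: "\<eta> > 0"
  shows "\<forall>\<^sub>F n in sequentially. \<exists>h1 h2. (\<forall>x. 0 \<le> h1 x \<and> h1 x \<le> 1) \<and> (\<forall>y. 0 \<le> h2 y \<and> h2 y \<le> 1) \<and>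
    exp (- \<eta> * real n) \<le> mean n undefined (fst_weight P) h1 \<and>
    exp (- \<eta> * real n) \<le> mean n undefined (snd_weight P) h2 \<and>
    source_mean n Q (\<lambda>w. h1 (\<lambda>i. fst (w i)) * h2 (\<lambda>i. snd (w i))) \<le> type2_error Q \<Gamma> n (m n) (f n) (g n)"
proof -
  \<comment> \<open>Through \<open>exp (- t) \<le> 1 / t\<close>, this \<open>t\<close> brings the
    term \<open>CARD('x) * exp (- t)\<close> of the counting bound down to
    \<open>\<eta> / 4\<close>; \<open>s\<close> is then chosen to make
    \<open>t * s = \<eta> / 4\<close>.\<close>
  define t where "t = 4 * CARD('x) / \<eta>"
  have t: "t > 0" using \<eta> by (simp add: t_def)
  have "t \<le> exp t" using exp_ge_add_one_self[of t] by linarith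
  then have "exp (- t) \<le> 1 / t"
    using t by (simp add: exp_minus field_simps)
  then have et: "CARD('x) * exp (- t) \<le> \<eta> / 4"
    using \<eta> by (simp add: t_def field_simps)
  define s where "s = \<eta> / (4 * t)"
  have s: "s > 0" "t * s = \<eta> / 4" using t \<eta> by (auto simp: s_def)
  have ev: "\<forall>\<^sub>F n in sequentially. exp (- \<eta> / 2 * real n) \<le> a"
    using a \<eta> by real_asymp
  have "\<forall>\<^sub>F n in sequentially. m n \<le> n \<and>
     (\<forall>u\<in>seqs n undefined. real (card {i. i < m n \<and> f n u i \<noteq> 0}) \<le> s * real n)"
    using sparse s by (simp add: sparse_inputs_def)
  then show ?thesis
    using acc ev
  proof eventually_elim
    case (elim n)
    \<comment> \<open>Encoder outputs from position \<open>m n\<close> on are arbitrary; resetting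
      them to 0 identifies inputs that agree on the positions used, so that they can be
      counted.\<close>
    define \<rho> where "\<rho> = (\<lambda>u i. if i < m n then f n u i else 0)"
    define S where "S = \<rho> ` seqs n undefined"
    have fin: "finite S" by (simp add: S_def)
    have ne: "S \<noteq> {}" by (auto simp: S_def seqs_def)
    have "real (card S) \<le> exp (t * (s * real n)) * exp (CARD('x) * exp (- t)) ^ m n"
    proof (rule card_sparse_le)
      fix x assume "x \<in> S"
      then obtain u where "u \<in> seqs n undefined" "x = \<rho> u" by (auto simp: S_def)
      moreover have "{i. i < m n \<and> \<rho> u i \<noteq> 0} = {i. i < m n \<and> f n u i \<noteq> 0}"
        by (auto simp: \<rho>_def)
      ultimately show "x \<in> seqs (m n) 0 \<and> real (card {i. i < m n \<and> x i \<noteq> 0}) \<le> s * real n"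
        using elim by (auto simp: seqs_def \<rho>_def)
    qed (use t in simp)
    also have "\<dots> \<le> exp (\<eta> / 4 * n) * exp (\<eta> / 4 * n)"
    proof (rule mult_mono)
      have "exp (CARD('x) * exp (- t)) ^ m n \<le> exp (\<eta> / 4) ^ m n"
        using et by (intro power_mono) auto
      also have "\<dots> \<le> exp (\<eta> / 4) ^ n"
        using elim \<eta> by (intro power_increasing) auto
      finally show "exp (CARD('x) * exp (- t)) ^ m n \<le> exp (\<eta> / 4 * n)"
        by (simp only: exp_of_nat2_mult)
    qed (use s in \<open>auto simp flip: mult.assoc\<close>)
    finally have card: "real (card S) \<le> exp (\<eta> / 2 * n)" by (simp flip: exp_add)
    let ?A = "\<lambda>x w. accept_prob \<Gamma> (m n) x (g n (\<lambda>i. snd (w i)))"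
    have A: "?A (f n (\<lambda>i. fst (w i))) w = ?A (\<rho> (\<lambda>i. fst (w i))) w" for w :: "nat \<Rightarrow> 'u \<times> 'v"
      unfolding accept_prob_def prob_Pi_pmf_eq by (simp add: \<rho>_def)
    let ?B = "\<lambda>x w. of_bool (\<rho> (\<lambda>i. fst (w i)) = x) * ?A x w"
    have "\<exists>x\<in>S. a / card S \<le> source_mean n P (?B x)"
    proof (rule ccontr)
      assume "\<not> ?thesis"
      then have "(\<Sum>x\<in>S. source_mean n P (?B x)) < (\<Sum>x\<in>S. a / card S)"
        by (intro sum_strict_mono fin ne) (auto simp: not_le)
      also have "\<dots> = a" using fin ne by simp
      also have "a \<le> source_mean n P (\<lambda>w. ?A (\<rho> (\<lambda>i. fst (w i))) w)"
        using elim by (simp add: type2_error_eq A)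
      also have "\<dots> = source_mean n P (\<lambda>w. \<Sum>x\<in>S. ?B x w)"
      proof (rule mean_cong)
        fix w :: "nat \<Rightarrow> 'u \<times> 'v" assume "w \<in> seqs n (undefined, undefined)"
        then have "\<rho> (\<lambda>i. fst (w i)) \<in> S" by (auto simp: S_def fst_seqs)
        moreover have "?B x w = (if x = \<rho> (\<lambda>i. fst (w i)) then ?A x w else 0)" for x by auto
        ultimately show "?A (\<rho> (\<lambda>i. fst (w i))) w = (\<Sum>x\<in>S. ?B x w)"
          using fin by (simp only: sum.delta) simp
      qed
      also have "\<dots> = (\<Sum>x\<in>S. source_mean n P (?B x))" by (rule mean_sum)
      finally show False by simp
    qed
    then obtain x where x: "a / card S \<le> source_mean n P (?B x)" by blast
    let ?h1 = "\<lambda>u. of_bool (\<rho> u = x) :: real" and ?h2 = "\<lambda>v. accept_prob \<Gamma> (m n) x (g n v)"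
    have "exp (- \<eta> * real n) = exp (- \<eta> / 2 * real n) / exp (\<eta> / 2 * n)"
      by (simp flip: exp_diff)
    also have "\<dots> \<le> a / card S"
      using elim card fin ne a by (intro frac_le) (auto simp: card_gt_0_iff)
    also note x
    finally have low: "exp (- \<eta> * real n) \<le> source_mean n P (?B x)" .
    have "source_mean n P (?B x) \<le> source_mean n P (\<lambda>w. ?h1 (\<lambda>i. fst (w i)))"
      by (intro mean_mono) (auto simp: accept_prob_bounds)
    also have "\<dots> = mean n undefined (fst_weight P) ?h1" by (rule source_mean_fst)
    finally have 1: "exp (- \<eta> * real n) \<le> mean n undefined (fst_weight P) ?h1"
      using low by simp
    have "source_mean n P (?B x) \<le> source_mean n P (\<lambda>w. ?h2 (\<lambda>i. snd (w i)))"
      by (intro mean_mono) (auto simp: accept_prob_bounds)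
    also have "\<dots> = mean n undefined (snd_weight P) ?h2" by (rule source_mean_snd)
    finally have 2: "exp (- \<eta> * real n) \<le> mean n undefined (snd_weight P) ?h2"
      using low by simp
    have "source_mean n Q (?B x) \<le> source_mean n Q (\<lambda>w. ?A (\<rho> (\<lambda>i. fst (w i))) w)"
      by (intro mean_mono) (auto simp: accept_prob_bounds)
    then have 3: "source_mean n Q (\<lambda>w. ?h1 (\<lambda>i. fst (w i)) * ?h2 (\<lambda>i. snd (w i))) \<le> type2_error Q \<Gamma> n (m n) (f n) (g n)"
      by (simp add: type2_error_eq A)
    show ?case
      using 1 2 3 by (intro exI[of _ ?h1] exI[of _ ?h2]) (auto simp: accept_prob_bounds)
  qed
qed

text \<open>Up to a subexponential factor, acceptance dominates a product test that is not
  negligible under the marginals of \<open>P\<close>; \<open>typical_mass_le\<close> then bounds the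
  typical mass by the type-II error. The conclusion mentions no code, so it can feed the
  construction for the other problem.\<close>

lemma exponent_converse:
  fixes P Q :: "('u::finite \<times> 'v::finite) pmf" and \<Gamma> :: "'x::{finite, zero} \<Rightarrow> 'y::finite pmf"
  assumes Q: "\<And>u v. pmf Q (u, v) > 0" and \<epsilon>: "\<epsilon> < 1"
    and ach: "achieves P Q \<Gamma> m \<epsilon> \<theta> f g" and sparse: "sparse_inputs m f" and \<theta>': "\<theta>' < \<theta>"
  shows "\<exists>\<delta>>0. \<forall>\<^sub>F n in sequentially. source_mean n Q (indicator (region P \<Gamma> \<delta> n)) \<le> exp (- \<theta>' * real n)"
proof -
  \<comment> \<open>The gap is split in three: for \<open>typical_mass_le\<close>, for the reduction
    to a product test, and for passing from a liminf to an eventual bound.\<close>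
  define \<xi> where "\<xi> = (\<theta> - \<theta>') / 3"
  have \<xi>: "\<xi> > 0" using \<theta>' by (simp add: \<xi>_def)
  have Q': "pmf Q z > 0" for z using Q by (cases z) auto
  define good where "good = (\<lambda>\<delta> \<eta>. \<forall>\<^sub>F n in sequentially. \<forall>h1 h2 T.
      (\<forall>x. 0 \<le> h1 x \<and> h1 x \<le> 1) \<and> (\<forall>x. 0 \<le> h2 x \<and> h2 x \<le> 1) \<and>
      mean n undefined (fst_weight P) h1 \<ge> exp (- \<eta> * real n) \<and>
      mean n undefined (snd_weight P) h2 \<ge> exp (- \<eta> * real n) \<and>
      (h1 = (\<lambda>_. 1) \<or> (\<forall>w\<in>T. typical (fst_weight P) \<delta> n (\<lambda>i. fst (w i)))) \<and>
      (\<forall>w\<in>T. typical (snd_weight P) \<delta> n (\<lambda>i. snd (w i))) \<longrightarrow>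
      source_mean n Q (indicator T) \<le>
        exp (\<xi> * n) * source_mean n Q (\<lambda>w. h1 (\<lambda>i. fst (w i)) * h2 (\<lambda>i. snd (w i))))"
  have "\<exists>\<delta>>0. \<exists>\<eta>>0. good \<delta> \<eta>"
    unfolding good_def
    by (rule typical_mass_le) (auto simp: Q sum_pmf_eq_1 sum_nonneg sum_image_weight \<xi>)
  then obtain \<delta> \<eta>0 where \<delta>: "\<delta> > 0" and \<eta>0: "\<eta>0 > 0" and "good \<delta> \<eta>0" by blast
  then have mass: "\<forall>\<^sub>F n in sequentially. \<forall>h1 h2 T.
      (\<forall>x. 0 \<le> h1 x \<and> h1 x \<le> 1) \<and> (\<forall>x. 0 \<le> h2 x \<and> h2 x \<le> 1) \<and>
      mean n undefined (fst_weight P) h1 \<ge> exp (- \<eta>0 * real n) \<and>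
      mean n undefined (snd_weight P) h2 \<ge> exp (- \<eta>0 * real n) \<and>
      (h1 = (\<lambda>_. 1) \<or> (\<forall>w\<in>T. typical (fst_weight P) \<delta> n (\<lambda>i. fst (w i)))) \<and>
      (\<forall>w\<in>T. typical (snd_weight P) \<delta> n (\<lambda>i. snd (w i))) \<longrightarrow>
      source_mean n Q (indicator T) \<le>
        exp (\<xi> * n) * source_mean n Q (\<lambda>w. h1 (\<lambda>i. fst (w i)) * h2 (\<lambda>i. snd (w i)))" by (simp only: good_def)
  define \<eta> where "\<eta> = min \<eta>0 \<xi>"
  have \<eta>: "\<eta> > 0" "\<eta> \<le> \<eta>0" "\<eta> \<le> \<xi>" using \<eta>0 \<xi> by (auto simp: \<eta>_def)
  define a where "a = (1 - \<epsilon>) / 2"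
  have a: "a > 0" using \<epsilon> by (simp add: a_def)
  have acc: "\<forall>\<^sub>F n in sequentially. type2_error P \<Gamma> n (m n) (f n) (g n) \<ge> a"
    using achieves_acceptance[OF ach, of "1 - a"] \<epsilon> by (simp add: a_def field_simps)
  have rect: "\<forall>\<^sub>F n in sequentially. \<exists>h1 h2.
      (\<forall>x. 0 \<le> h1 x \<and> h1 x \<le> 1) \<and> (\<forall>x. 0 \<le> h2 x \<and> h2 x \<le> 1) \<and>
      exp (- \<eta> * real n) \<le> mean n undefined (fst_weight P) h1 \<and>
      exp (- \<eta> * real n) \<le> mean n undefined (snd_weight P) h2 \<and>
      (same_supports \<Gamma> \<longrightarrow> h1 = (\<lambda>_. 1)) \<and>
      exp (- \<eta> * real n) * source_mean n Q (\<lambda>w. h1 (\<lambda>i. fst (w i)) * h2 (\<lambda>i. snd (w i)))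
        \<le> type2_error Q \<Gamma> n (m n) (f n) (g n)"
  proof (cases "same_supports \<Gamma>")
    case True
    show ?thesis
      using rectangle_same_supports[OF True sparse acc a \<eta>(1), of Q]
    proof eventually_elim
      case (elim n)
      then obtain h where h: "\<forall>y. 0 \<le> h y \<and> h y \<le> 1"
        "exp (- \<eta> * real n) \<le> mean n undefined (snd_weight P) h"
        "exp (- \<eta> * real n) * source_mean n Q (\<lambda>w. h (\<lambda>i. snd (w i))) \<le> type2_error Q \<Gamma> n (m n) (f n) (g n)"
        by blast
      have "mean n undefined (fst_weight P) (\<lambda>_. 1) = 1"
        by (intro mean_const sum_image_weight)
      then show ?case
        using h \<eta> by (intro exI[of _ "\<lambda>_. 1"] exI[of _ h]) auto
    qed
  next
    case False
    show ?thesis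
      using rectangle_few_inputs[OF sparse acc a \<eta>(1), of Q]
    proof eventually_elim
      case (elim n)
      then obtain h1 h2 where h: "\<forall>x. 0 \<le> h1 x \<and> h1 x \<le> 1" "\<forall>y. 0 \<le> h2 y \<and> h2 y \<le> 1"
        "exp (- \<eta> * real n) \<le> mean n undefined (fst_weight P) h1"
        "exp (- \<eta> * real n) \<le> mean n undefined (snd_weight P) h2"
        "source_mean n Q (\<lambda>w. h1 (\<lambda>i. fst (w i)) * h2 (\<lambda>i. snd (w i))) \<le> type2_error Q \<Gamma> n (m n) (f n) (g n)"
        by blast
      have "exp (- \<eta> * real n) * source_mean n Q (\<lambda>w. h1 (\<lambda>i. fst (w i)) * h2 (\<lambda>i. snd (w i)))
          \<le> 1 * source_mean n Q (\<lambda>w. h1 (\<lambda>i. fst (w i)) * h2 (\<lambda>i. snd (w i)))"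
        using \<eta> h by (intro mult_right_mono mean_nonneg mult_nonneg_nonneg) auto
      with h False show ?case
        by (intro exI[of _ h1] exI[of _ h2]) auto
    qed
  qed
  have "\<forall>\<^sub>F n in sequentially. type2_error Q \<Gamma> n (m n) (f n) (g n) \<le> exp (- (\<theta> - \<xi>) * real n)"
    using ach \<xi> by (intro achieves_type2_le) auto
  with mass rect have "\<forall>\<^sub>F n in sequentially. source_mean n Q (indicator (region P \<Gamma> \<delta> n)) \<le> exp (- \<theta>' * real n)"
  proof eventually_elim
    case (elim n)
    let ?T = "region P \<Gamma> \<delta> n"
    obtain h1 h2 where h: "\<forall>x. 0 \<le> h1 x \<and> h1 x \<le> 1" "\<forall>y. 0 \<le> h2 y \<and> h2 y \<le> 1"
      "exp (- \<eta> * real n) \<le> mean n undefined (fst_weight P) h1"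
      "exp (- \<eta> * real n) \<le> mean n undefined (snd_weight P) h2"
      "same_supports \<Gamma> \<longrightarrow> h1 = (\<lambda>_. 1)"
      and t2: "exp (- \<eta> * real n) * source_mean n Q (\<lambda>w. h1 (\<lambda>i. fst (w i)) * h2 (\<lambda>i. snd (w i)))
        \<le> type2_error Q \<Gamma> n (m n) (f n) (g n)"
      using elim(2) by (elim exE conjE) (rule that)
    let ?H = "source_mean n Q (\<lambda>w. h1 (\<lambda>i. fst (w i)) * h2 (\<lambda>i. snd (w i)))"
    have le: "exp (- \<eta>0 * real n) \<le> exp (- \<eta> * real n)"
      using \<eta> by (simp add: mult_right_mono)
    have "source_mean n Q (indicator ?T) \<le> exp (\<xi> * n) * ?H"
      using h(1,2,5) order_trans[OF le h(3)] order_trans[OF le h(4)]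
      by (intro elim(1)[rule_format] conjI) (auto simp: region_def)
    also have "\<dots> = exp (\<xi> * n) * (exp (\<eta> * n) * (exp (- \<eta> * real n) * ?H))"
      by (simp add: exp_minus field_simps)
    also have "\<dots> \<le> exp (\<xi> * n) * (exp (\<eta> * n) * exp (- (\<theta> - \<xi>) * real n))"
      using t2 elim(3) by (intro mult_left_mono) auto
    also have "\<dots> = exp ((\<eta> + \<xi> + \<xi> - \<theta>) * real n)"
      unfolding exp_add[symmetric] by (simp add: algebra_simps)
    also have "\<dots> \<le> exp (- \<theta>' * real n)"
      unfolding exp_le_cancel_iff using \<eta>(3) by (intro mult_right_mono) (auto simp: \<xi>_def field_simps)
    finally show ?case .
  qed
  with \<delta> show ?thesis by blast
qed

section \<open>Comparison of the two suprema\<close>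

text \<open>The converse loses an arbitrarily small amount, so membership passes only to strictly
  smaller exponents, which leaves the supremum unchanged. Positivity of the elements of
  \<open>T\<close> settles the convention that the empty set gives 0.\<close>

lemma exponent_Sup_le:
  assumes "\<And>\<theta>. \<theta> \<in> S \<Longrightarrow> \<theta> > 0"
    and "\<And>\<theta> \<theta>'. \<theta> \<in> S \<Longrightarrow> 0 < \<theta>' \<Longrightarrow> \<theta>' < \<theta> \<Longrightarrow> \<theta>' \<in> T"
    and "\<And>\<theta>. \<theta> \<in> T \<Longrightarrow> \<theta> > 0"
  shows "exponent_Sup S \<le> exponent_Sup T"
proof (cases "S = {}")
  case True
  have "0 \<le> Sup (ereal ` T)" if "T \<noteq> {}"
  proof -
    from that obtain \<theta> where "\<theta> \<in> T" by blast
    with assms(3) show ?thesis by (intro Sup_upper2[of "ereal \<theta>"]) (auto intro: less_imp_le)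
  qed
  with True show ?thesis by (simp add: exponent_Sup_def)
next
  case False
  then obtain \<theta>0 where "\<theta>0 \<in> S" by blast
  with assms(1,2)[of \<theta>0] have "\<theta>0 / 2 \<in> T" by simp
  then have T: "T \<noteq> {}" by blast
  have "ereal \<theta> \<le> Sup (ereal ` T)" if "\<theta> \<in> S" for \<theta>
  proof (rule dense_le)
    fix z assume "z < ereal \<theta>"
    then obtain r where r: "z < ereal r" "r < \<theta>" using ereal_dense2 by force
    \<comment> \<open>The maximum keeps the exponent positive when \<open>r\<close> is not.\<close>
    have "max r (\<theta> / 2) \<in> T"
      using assms(1)[OF that] r by (intro assms(2)[OF that]) auto
    then have "ereal (max r (\<theta> / 2)) \<le> Sup (ereal ` T)" by (intro Sup_upper imageI)
    moreover have "ereal r \<le> ereal (max r (\<theta> / 2))"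
      by (simp only: ereal_less_eq max.cobounded1)
    with r(1) have "z \<le> ereal (max r (\<theta> / 2))" by (rule less_imp_le[OF less_le_trans])
    ultimately show "z \<le> Sup (ereal ` T)" by (rule order_trans[rotated])
  qed
  then show ?thesis using False T by (auto simp: exponent_Sup_def intro!: Sup_least)
qed

text \<open>Every \<open>u\<close> has positive probability under \<open>Q\<close>, so the
  almost-sure bound holds for every source sequence.\<close>

lemma meets_costD:
  fixes Q :: "('u::finite \<times> 'v::finite) pmf"
  assumes Q: "\<And>u v. pmf Q (u, v) > 0" and "meets_cost Q \<Gamma> c B n f" and u: "u \<in> seqs n undefined"
  shows "(\<Sum>i<n. c (f u i)) \<le> B"
proof -
  \<comment> \<open>Any companion sequence would do on the first \<open>n\<close> coordinates;
    \<open>undefined\<close> also fits the default value outside them.\<close>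
  define w where "w = (\<lambda>i. (u i, undefined :: 'v))"
  have "pmf (Pi_pmf {..<n} (undefined, undefined) (\<lambda>_. Q)) w > 0"
    using u Q by (auto simp: pmf_Pi w_def seqs_def intro!: prod_pos)
  then have w: "w \<in> set_pmf (Pi_pmf {..<n} (undefined, undefined) (\<lambda>_. Q))"
    by (simp add: set_pmf_iff)
  obtain y where y: "y \<in> set_pmf (Pi_pmf {..<n} undefined (\<lambda>i. \<Gamma> (f u i)))"
    using set_pmf_not_empty by fast
  have "((\<lambda>i. fst (w i)), (\<lambda>i. snd (w i)), f (\<lambda>i. fst (w i)), y) \<in> set_pmf (system_pmf Q \<Gamma> n n f)"
    using w y by (auto simp: system_pmf_def Let_def w_def intro!: bexI[of _ w])
  then show ?thesis
    using assms(2) by (fastforce simp: meets_cost_def AE_measure_pmf_iff w_def)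
qed

lemma meets_costI:
  assumes "\<And>u. (\<Sum>i<n. c (f u i)) \<le> B"
  shows "meets_cost R \<Gamma> c B n f"
  using assms by (auto simp: meets_cost_def AE_measure_pmf_iff system_pmf_def Let_def)

lemma sparse_inputs_sublinear:
  assumes "(\<lambda>n. real (k n) / real n) \<longlonglongrightarrow> 0"
  shows "sparse_inputs k f"
  unfolding sparse_inputs_def
proof (intro allI impI)
  fix \<eta> :: real assume "\<eta> > 0"
  then have "\<forall>\<^sub>F n in sequentially. real (k n) / real n < min \<eta> 1"
    using assms by (intro order_tendstoD) auto
  then show "\<forall>\<^sub>F n in sequentially. k n \<le> n \<and>
     (\<forall>u\<in>seqs n undefined. real (card {i. i < k n \<and> f n u i \<noteq> 0}) \<le> \<eta> * real n)"
    using eventually_gt_at_top[of 0]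
  proof eventually_elim
    case (elim n)
    then have k: "real (k n) \<le> \<eta> * real n" "k n \<le> n"
      by (auto simp: field_simps)
    have "card {i. i < k n \<and> f n u i \<noteq> 0} \<le> k n" for u
      using card_mono[of "{..<k n}" "{i. i < k n \<and> f n u i \<noteq> 0}"] by auto
    then show ?case using k by (meson of_nat_mono order_trans)
  qed
qed

text \<open>Over a finite alphabet the nonzero letters have costs bounded below by some
  \<open>b > 0\<close>, so at most \<open>C n / b\<close> of them fit the budget.\<close>

lemma sparse_inputs_cost:
  fixes Q :: "('u::finite \<times> 'v::finite) pmf" and c :: "'x::{finite, zero} \<Rightarrow> real"
  assumes Q: "\<And>u v. pmf Q (u, v) > 0"
    and c: "\<And>x. c x \<ge> 0" "\<And>x. c x = 0 \<longleftrightarrow> x = 0"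
    and C: "(\<lambda>n. C n / real n) \<longlonglongrightarrow> 0"
    and cost: "\<And>n. n \<ge> 1 \<Longrightarrow> meets_cost Q \<Gamma> c (C n) n (f n)"
  shows "sparse_inputs (\<lambda>n. n) f"
  unfolding sparse_inputs_def
proof (intro allI impI)
  fix \<eta> :: real assume \<eta>: "\<eta> > 0"
  \<comment> \<open>Inserting 1 keeps the set nonempty when 0 is the only letter.\<close>
  define b where "b = Min (insert 1 (c ` {x. x \<noteq> 0}))"
  have "c x > 0" if "x \<noteq> 0" for x using c(1)[of x] c(2)[of x] that by linarith
  then have b: "b > 0" by (auto simp: b_def)
  have bc: "b * of_bool (x \<noteq> 0) \<le> c x" for x using c(1)[of x] by (auto simp: b_def)
  have "\<forall>\<^sub>F n in sequentially. C n / real n < b * \<eta>"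
    using C b \<eta> by (intro order_tendstoD) auto
  then show "\<forall>\<^sub>F n in sequentially. n \<le> n \<and>
     (\<forall>u\<in>seqs n undefined. real (card {i. i < n \<and> f n u i \<noteq> 0}) \<le> \<eta> * real n)"
    using eventually_ge_at_top[of 1]
  proof eventually_elim
    case (elim n)
    have "real (card {i. i < n \<and> f n u i \<noteq> 0}) \<le> \<eta> * real n" if "u \<in> seqs n undefined" for u
    proof -
      have "b * real (card {i. i < n \<and> f n u i \<noteq> 0}) = (\<Sum>i<n. b * of_bool (f n u i \<noteq> 0))"
        by (simp add: Int_def flip: sum_distrib_left)
      also have "\<dots> \<le> (\<Sum>i<n. c (f n u i))" by (intro sum_mono bc)
      also have "\<dots> \<le> C n" by (rule meets_costD[OF Q cost that]) (use elim in auto)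
      also have "\<dots> \<le> b * (\<eta> * real n)" using elim by (simp add: field_simps)
      finally show ?thesis using b by simp
    qed
    then show ?case by simp
  qed
qed

theorem theorem3:
  fixes P Q :: "('u::finite \<times> 'v::finite) pmf"
    and \<Gamma> :: "'x::{finite, zero} \<Rightarrow> 'y::finite pmf"
    and c :: "'x \<Rightarrow> real"
    and C :: "nat \<Rightarrow> real"
    and k :: "nat \<Rightarrow> nat"
    and \<epsilon> :: real
  assumes Q_pos: "\<And>u v. pmf Q (u, v) > 0"
    and c_nonneg: "\<And>x. c x \<ge> 0"
    and c_zero: "\<And>x. c x = 0 \<longleftrightarrow> x = 0"
    and C_nonneg: "\<And>n. n \<ge> 1 \<Longrightarrow> C n \<ge> 0"
    and C_lim: "filterlim C at_top sequentially"
    and C_sublin: "(\<lambda>n. C n / real n) \<longlonglongrightarrow> 0"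
    and k_pos: "\<And>n. n \<ge> 1 \<Longrightarrow> k n > 0"
    and k_lim: "filterlim k at_top sequentially"
    and k_sublin: "(\<lambda>n. real (k n) / real n) \<longlonglongrightarrow> 0"
    and eps: "0 \<le> \<epsilon>" "\<epsilon> < 1"
  shows "theta_str_cost P Q \<Gamma> c \<epsilon> C = theta_sublin P Q \<Gamma> k \<epsilon>"
proof -
  let ?A = "{\<theta>. \<theta> > 0 \<and> (\<exists>f g. achieves P Q \<Gamma> (\<lambda>n. n) \<epsilon> \<theta> f g \<and>
        (\<forall>n\<ge>1. meets_cost P \<Gamma> c (C n) n (f n) \<and> meets_cost Q \<Gamma> c (C n) n (f n)))}"
  let ?B = "{\<theta>. \<theta> > 0 \<and> (\<exists>f g. achieves P Q \<Gamma> k \<epsilon> \<theta> f g)}"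
  \<comment> \<open>The converse leaves only the decay of the mass of a typical region; the
    construction is then run with \<open>k\<close> in place of both \<open>m\<close> and
    \<open>j\<close>.\<close>
  have AB: "\<theta>' \<in> ?B" if \<theta>: "\<theta> \<in> ?A" "0 < \<theta>'" "\<theta>' < \<theta>" for \<theta> \<theta>'
  proof -
    obtain f g where f: "achieves P Q \<Gamma> (\<lambda>n. n) \<epsilon> \<theta> f g" "\<And>n. n \<ge> 1 \<Longrightarrow> meets_cost Q \<Gamma> c (C n) n (f n)"
      using \<theta>(1) by blast
    have "sparse_inputs (\<lambda>n. n) f"
      by (rule sparse_inputs_cost[OF Q_pos c_nonneg c_zero C_sublin f(2)])
    then obtain \<delta> where "\<delta> > 0"
      "\<forall>\<^sub>F n in sequentially. source_mean n Q (indicator (region P \<Gamma> \<delta> n)) \<le> exp (- \<theta>' * real n)"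
      using exponent_converse[OF Q_pos eps(2) f(1) _ \<theta>(3)] by blast
    then have "\<exists>f g. achieves P Q \<Gamma> k \<epsilon> \<theta>' f g"
      using exponent_achievable[OF _ eps(1) _ k_lim, of _ Q P \<Gamma> \<theta>' k] by blast
    with \<theta>(2) show ?thesis by blast
  qed
  have BA: "\<theta>' \<in> ?A" if \<theta>: "\<theta> \<in> ?B" "0 < \<theta>'" "\<theta>' < \<theta>" for \<theta> \<theta>'
  proof -
    obtain f g where f: "achieves P Q \<Gamma> k \<epsilon> \<theta> f g"
      using \<theta>(1) by blast
    obtain \<delta> where \<delta>: "\<delta> > 0"
      "\<forall>\<^sub>F n in sequentially. source_mean n Q (indicator (region P \<Gamma> \<delta> n)) \<le> exp (- \<theta>' * real n)"
      using exponent_converse[OF Q_pos eps(2) f sparse_inputs_sublinear[OF k_sublin] \<theta>(3)] by blast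
    \<comment> \<open>An upper bound for every letter cost; the summand 1 makes it positive even if
      all costs vanish.\<close>
    define K where "K = 1 + (\<Sum>x\<in>UNIV. c x)"
    have K: "K > 0" using c_nonneg by (simp add: K_def add_pos_nonneg sum_nonneg)
    have cK: "c x \<le> K" for x
      using member_le_sum[of x UNIV c] c_nonneg by (simp add: K_def)
    \<comment> \<open>As many letters of cost at most \<open>K\<close> as the budget allows, capped
      by the \<open>n\<close> channel uses. It tends to infinity because \<open>C\<close>
      does.\<close>
    define j where "j = (\<lambda>n. min n (nat \<lfloor>C n / K\<rfloor>))"
    have "filterlim (\<lambda>n. C n / K) at_top sequentially"
      using C_lim K by (simp add: divide_inverse filterlim_at_top_mult_tendsto_pos[OF tendsto_const, rotated 1])
    then have "filterlim (\<lambda>n. nat \<lfloor>C n / K\<rfloor>) at_top sequentially"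
      by (intro filterlim_compose[OF filterlim_nat_sequentially] filterlim_compose[OF filterlim_floor_sequentially])
    then have "filterlim j at_top sequentially"
      unfolding j_def filterlim_at_top
      by (auto intro: eventually_conj simp: eventually_conj_iff eventually_ge_at_top)
    then obtain f' g' where f': "achieves P Q \<Gamma> (\<lambda>n. n) \<epsilon> \<theta>' f' g'"
      and zero: "\<And>n u i. j n \<le> i \<Longrightarrow> f' n u i = 0"
      using exponent_achievable[OF \<delta>(1) eps(1) \<delta>(2), of j "\<lambda>n. n"] by (auto simp: j_def)
    have "(\<Sum>i<n. c (f' n u i)) \<le> C n" if "n \<ge> 1" for n u
    proof -
      have "(\<Sum>i<n. c (f' n u i)) = (\<Sum>i<j n. c (f' n u i))"
        using zero c_zero by (intro sum.mono_neutral_right) (auto simp: j_def not_less)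
      also have "\<dots> \<le> real (j n) * K"
        using sum_mono[of "{..<j n}" "\<lambda>i. c (f' n u i)" "\<lambda>_. K"] cK by simp
      also have "\<dots> \<le> C n / K * K"
      proof (rule mult_right_mono)
        have "real (j n) \<le> real (nat \<lfloor>C n / K\<rfloor>)" by (simp add: j_def)
        also have "\<dots> \<le> C n / K" using C_nonneg[OF that] K by (intro of_nat_floor) simp
        finally show "real (j n) \<le> C n / K" .
      qed (use K in simp)
      finally show ?thesis using K by simp
    qed
    then have "meets_cost R \<Gamma> c (C n) n (f' n)" if "n \<ge> 1" for R n
      using that by (intro meets_costI)
    with f' \<theta>(2) show ?thesis by blast
  qed
  show ?thesis
    unfolding theta_str_cost_def theta_sublin_def
    by (rule antisym; rule exponent_Sup_le) (use AB BA in blast)+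
qed

end
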